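(* The graph $\Gamma$, whose vertices are the elliptic ovoids of the symplectic subquadrangles of the Hermitian surface $\mathcal{H}(3,4)$ of $\mathrm{PG}(3,4)$, two vertices being adjacent whenever they meet in exactly one point and their symplectic subquadrangles meet in exactly six points, is a strongly regular graph with parameters $(216, 40, 4, 8)$.
   Context: A strongly regular graph with parameters $(v,k,\lambda,\mu)$ is a simple, undirected, connected graph with $v$ vertices such that each vertex lies on $k$ edges, any two adjacent vertices have exactly $\lambda$ common neighbours, and any two distinct non-adjacent vertices have exactly $\mu$ common neighbours. Let $\perp$ be a non-degenerate unitary polarity of $\mathrm{PG}(3,4)$ and let $\mathcal{H}(3,4)$ be the Hermitian surface it defines, i.e. the incidence structure of the points and lines of $\mathrm{PG}(3,4)$ that are totally isotropic with respect to $\perp$ (it has $45$ points and $27$ lines, and is a generalized quadrangle of order $(4,2)$). Symplectic subquadrangles: let $\Sigma$ be a Baer subgeometry of $\mathrm{PG}(3,4)$, i.e. a subgeometry isomorphic to $\mathrm{PG}(3,2)$, and let $\mathcal{W}=\mathcal{W}(3,2)$ be the incidence structure of all points of $\Sigma$ (there are $15$) and of the $15$ lines of $\Sigma$ (called generators of $\mathcal{W}$) that are totally isotropic with respect to a non-degenerate symplectic polarity of $\Sigma$. This polarity extends uniquely to a symplectic polarity $\tilde{\perp}$ of $\mathrm{PG}(3,4)$. $\mathcal{W}$ is called a symplectic subquadrangle of $\mathcal{H}(3,4)$ if $\tilde{\perp}\perp=\perp\tilde{\perp}=\sigma$, where $\sigma$ is a semilinear involution whose set of fixed points is $\Sigma$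 (so all points of $\Sigma$ lie on $\mathcal{H}(3,4)$ and $\perp$, $\tilde{\perp}$ induce the same polarity on $\Sigma$). For two symplectic subquadrangles $\mathcal{W},\mathcal{W}'$, the intersection $\mathcal{W}\cap\mathcal{W}'$ denotes the set of their common points; "meeting in $n$ points" means $|\mathcal{W}\cap\mathcal{W}'|=n$. Elliptic ovoids: an elliptic ovoid of $\mathcal{W}$ is an elliptic quadric $\mathcal{Q}^-(3,2)$ of $\Sigma$ (a set of $5$ points) such that the lines of $\Sigma$ tangent to it (meeting it in exactly one point) are precisely the $15$ generators of $\mathcal{W}$. An elliptic quadric of $\Sigma$ determines a unique symplectic quadrangle $\mathcal{W}$ of $\Sigma$ in this way, called the symplectic subquadrangle of the elliptic ovoid. *)

theory Defs
  imports "HOL-Analysis.Analysis" "HOL-Library.Z2" "Graph_Theory.Graph_Theory"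
begin

section \<open>Strongly regular graphs\<close>

definition strongly_regular_graph ::
    "'v pair_pre_digraph \<Rightarrow> nat \<Rightarrow> nat \<Rightarrow> nat \<Rightarrow> nat \<Rightarrow> bool" where
  "strongly_regular_graph G v k l m \<longleftrightarrow>
     pair_graph G \<and> Digraph_Component.connected (with_proj G) \<and>
     card (pverts G) = v \<and>
     (\<forall>x\<in>pverts G. out_degree (with_proj G) x = k) \<and>
     (\<forall>x\<in>pverts G. \<forall>y\<in>pverts G. (x, y) \<in> parcs G \<longrightarrow>
        card {z \<in> pverts G. (x, z) \<in> parcs G \<and> (y, z) \<in> parcs G} = l) \<and>
     (\<forall>x\<in>pverts G. \<forall>y\<in>pverts G. x \<noteq> y \<and> (x, y) \<notin> parcs G \<longrightarrow>
        card {z \<in> pverts G. (x, z) \<in> parcs G \<and> (y, z) \<in> parcs G} = m)"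


section \<open>Projective 3-space over a field\<close>

text \<open>Projective subspaces are represented by linear subspaces of the coordinate space, so a
  point is a set of vectors and incidence is inclusion.\<close>

definition pg_points :: "('a::field ^ 4) set set" where
  "pg_points = {U. vec.subspace U \<and> vec.dim U = 1}"

definition pg_lines :: "('a::field ^ 4) set set" where
  "pg_lines = {U. vec.subspace U \<and> vec.dim U = 2}"

definition points_on :: "('a::field ^ 4) set \<Rightarrow> ('a ^ 4) set set" where
  "points_on U = {P \<in> pg_points. P \<subseteq> U}"


section \<open>Polarities\<close>

definition nondegenerate :: "('a::field ^ 4 \<Rightarrow> 'a ^ 4 \<Rightarrow> 'a) \<Rightarrow> bool" where
  "nondegenerate f \<longleftrightarrow> (\<forall>u. (\<forall>v. f u v = 0) \<longrightarrow> u = 0)"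

definition form_perp :: "('a::field ^ 4 \<Rightarrow> 'a ^ 4 \<Rightarrow> 'a) \<Rightarrow> ('a ^ 4) set \<Rightarrow> ('a ^ 4) set" where
  "form_perp f U = {v. \<forall>u\<in>U. f u v = 0}"

text \<open>The square in the next definition is the conjugation of the field with four elements, the
  only field over which the notion is used. Linearity in the first argument and Hermitian symmetry
  together give semilinearity in the second.\<close>

definition hermitian_form :: "('a::field ^ 4 \<Rightarrow> 'a ^ 4 \<Rightarrow> 'a) \<Rightarrow> bool" where
  "hermitian_form h \<longleftrightarrow>
     (\<forall>v. Vector_Spaces.linear (*s) (*) (\<lambda>u. h u v)) \<and> (\<forall>u v. h v u = (h u v)\<^sup>2)"

definition unitary_polarity :: "(('a::field ^ 4) set \<Rightarrow> ('a ^ 4) set) \<Rightarrow> bool" where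
  "unitary_polarity p \<longleftrightarrow> (\<exists>h. hermitian_form h \<and> nondegenerate h \<and> p = form_perp h)"

definition bilinear_form :: "('a::field ^ 4 \<Rightarrow> 'a ^ 4 \<Rightarrow> 'a) \<Rightarrow> bool" where
  "bilinear_form f \<longleftrightarrow>
     (\<forall>v. Vector_Spaces.linear (*s) (*) (\<lambda>u. f u v)) \<and>
     (\<forall>u. Vector_Spaces.linear (*s) (*) (\<lambda>v. f u v))"

definition symplectic_polarity :: "(('a::field ^ 4) set \<Rightarrow> ('a ^ 4) set) \<Rightarrow> bool" where
  "symplectic_polarity t \<longleftrightarrow>
     (\<exists>f. bilinear_form f \<and> (\<forall>v. f v v = 0) \<and> nondegenerate f \<and> t = form_perp f)"


section \<open>Elliptic quadrics\<close>

definition polar_form :: "('a::field ^ 4 \<Rightarrow> 'a) \<Rightarrow> 'a ^ 4 \<Rightarrow> 'a ^ 4 \<Rightarrow> 'a" where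
  "polar_form Q u v = Q (u + v) - Q u - Q v"

definition quadratic_form :: "('a::field ^ 4 \<Rightarrow> 'a) \<Rightarrow> bool" where
  "quadratic_form Q \<longleftrightarrow> (\<forall>c v. Q (c *s v) = c\<^sup>2 * Q v) \<and> bilinear_form (polar_form Q)"

definition nonsingular :: "('a::field ^ 4 \<Rightarrow> 'a) \<Rightarrow> bool" where
  "nonsingular Q \<longleftrightarrow> (\<forall>v. Q v = 0 \<and> (\<forall>w. polar_form Q v w = 0) \<longrightarrow> v = 0)"

definition quadric :: "('a::field ^ 4 \<Rightarrow> 'a) \<Rightarrow> ('a ^ 4) set set" where
  "quadric Q = {P \<in> pg_points. \<forall>v\<in>P. Q v = 0}"

text \<open>Elliptic means non-singular of Witt index 1: there are points on the quadric, but no lines.\<close>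

definition elliptic_quadric :: "('a::field ^ 4) set set \<Rightarrow> bool" where
  "elliptic_quadric E \<longleftrightarrow>
     (\<exists>Q. quadratic_form Q \<and> nonsingular Q \<and> E = quadric Q) \<and>
     E \<noteq> {} \<and> (\<forall>L\<in>pg_lines. \<not> points_on L \<subseteq> E)"


section \<open>Baer subgeometries\<close>

text \<open>A Baer subgeometry of the projective space over the field with four elements is the set of
  the points that have coordinates in the prime field with respect to some basis, here the columns
  of an invertible matrix \<open>M\<close>. The map \<open>baer_ext M\<close> takes a subspace of \<open>PG(3,2)\<close>, i.e. of
  \<open>bit ^ 4\<close>, to the subspace of the big space generated by it. It identifies \<open>PG(3,2)\<close> with the
  subgeometry, and lines, polarities and quadrics of the subgeometry are given by those of
  \<open>PG(3,2)\<close>. A different basis of the same subgeometry changes this identification by a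
  collineation of \<open>PG(3,2)\<close> only, and such collineations are linear.\<close>

definition baer_vec :: "'a::field ^ 4 ^ 4 \<Rightarrow> bit ^ 4 \<Rightarrow> 'a ^ 4" where
  "baer_vec M x = M *v (\<chi> i. of_bit (x $ i))"

definition baer_ext :: "'a::field ^ 4 ^ 4 \<Rightarrow> (bit ^ 4) set \<Rightarrow> ('a ^ 4) set" where
  "baer_ext M U = vec.span (baer_vec M ` U)"

definition baer_points :: "'a::field ^ 4 ^ 4 \<Rightarrow> ('a ^ 4) set set" where
  "baer_points M = baer_ext M ` pg_points"

text \<open>A line of the subgeometry is the set of its three points in the subgeometry.\<close>

definition baer_line :: "'a::field ^ 4 ^ 4 \<Rightarrow> (bit ^ 4) set \<Rightarrow> ('a ^ 4) set set" where
  "baer_line M L = baer_ext M ` points_on L"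

definition baer_lines :: "'a::field ^ 4 ^ 4 \<Rightarrow> ('a ^ 4) set set set" where
  "baer_lines M = baer_line M ` pg_lines"

definition extends_polarity ::
    "'a::field ^ 4 ^ 4 \<Rightarrow> ((bit ^ 4) set \<Rightarrow> (bit ^ 4) set) \<Rightarrow> (('a ^ 4) set \<Rightarrow> ('a ^ 4) set) \<Rightarrow> bool"
  where
  "extends_polarity M t T \<longleftrightarrow> (\<forall>U. vec.subspace U \<longrightarrow> T (baer_ext M U) = baer_ext M (t U))"


section \<open>Symplectic subquadrangles and elliptic ovoids\<close>

definition semilinear_bij :: "('a::field ^ 4 \<Rightarrow> 'a ^ 4) \<Rightarrow> bool" where
  "semilinear_bij s \<longleftrightarrow> bij s \<and> (\<forall>u v. s (u + v) = s u + s v) \<and>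
     (\<exists>\<theta>. bij \<theta> \<and> (\<forall>a b. \<theta> (a + b) = \<theta> a + \<theta> b) \<and> (\<forall>a b. \<theta> (a * b) = \<theta> a * \<theta> b) \<and>
        (\<forall>c v. s (c *s v) = \<theta> c *s s v))"

text \<open>The collineation \<open>U \<mapsto> s ` U\<close> is an involution; \<open>s \<circ> s\<close> itself need only be a scalar map.\<close>

definition semilinear_involution :: "('a::field ^ 4 \<Rightarrow> 'a ^ 4) \<Rightarrow> bool" where
  "semilinear_involution s \<longleftrightarrow> semilinear_bij s \<and>
     (\<forall>U. vec.subspace U \<longrightarrow> s ` s ` U = U) \<and> (\<exists>U. vec.subspace U \<and> s ` U \<noteq> U)"

text \<open>Points and lines, the latter as sets of points.\<close>

type_synonym 'a quadrangle = "('a ^ 4) set set \<times> ('a ^ 4) set set set"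

definition symplectic_quadrangle ::
    "'a::field ^ 4 ^ 4 \<Rightarrow> ((bit ^ 4) set \<Rightarrow> (bit ^ 4) set) \<Rightarrow> 'a quadrangle" where
  "symplectic_quadrangle M t = (baer_points M, baer_line M ` {L \<in> pg_lines. L \<subseteq> t L})"

text \<open>The Hermitian surface, consisting of the points and lines \<open>U\<close> with \<open>U \<subseteq> perp U\<close>, enters
  through its unitary polarity \<open>perp\<close>. A fixed point \<open>P\<close> of \<open>T \<circ> perp\<close> satisfies
  \<open>perp P = T P\<close>, so the points of a symplectic subquadrangle do lie on the surface.\<close>

definition symplectic_subquadrangle ::
    "(('a::field ^ 4) set \<Rightarrow> ('a ^ 4) set) \<Rightarrow> 'a quadrangle \<Rightarrow> bool" where
  "symplectic_subquadrangle perp W \<longleftrightarrow>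
     (\<exists>M t T s. invertible M \<and> symplectic_polarity t \<and> W = symplectic_quadrangle M t \<and>
        symplectic_polarity T \<and> extends_polarity M t T \<and>
        semilinear_involution s \<and> {P \<in> pg_points. s ` P = P} = baer_points M \<and>
        (\<forall>U. vec.subspace U \<longrightarrow> T (perp U) = s ` U \<and> perp (T U) = s ` U))"

definition elliptic_ovoid :: "'a::field quadrangle \<Rightarrow> ('a ^ 4) set set \<Rightarrow> bool" where
  "elliptic_ovoid W X \<longleftrightarrow>
     (\<exists>M E. invertible M \<and> fst W = baer_points M \<and>
        elliptic_quadric E \<and> X = baer_ext M ` E \<and>
        {l \<in> baer_lines M. card (l \<inter> X) = 1} = snd W)"

definition subquadrangle_of ::
    "(('a::field ^ 4) set \<Rightarrow> ('a ^ 4) set) \<Rightarrow> ('a ^ 4) set set \<Rightarrow> 'a quadrangle" where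
  "subquadrangle_of perp X = (THE W. symplectic_subquadrangle perp W \<and> elliptic_ovoid W X)"

definition elliptic_ovoids ::
    "(('a::field ^ 4) set \<Rightarrow> ('a ^ 4) set) \<Rightarrow> ('a ^ 4) set set set" where
  "elliptic_ovoids perp = {X. \<exists>W. symplectic_subquadrangle perp W \<and> elliptic_ovoid W X}"

definition ovoid_graph ::
    "(('a::field ^ 4) set \<Rightarrow> ('a ^ 4) set) \<Rightarrow> ('a ^ 4) set set pair_pre_digraph" where
  "ovoid_graph perp =
     \<lparr>pverts = elliptic_ovoids perp,
      parcs = {(X, Y). X \<in> elliptic_ovoids perp \<and> Y \<in> elliptic_ovoids perp \<and>
        card (X \<inter> Y) = 1 \<and>
        card (fst (subquadrangle_of perp X) \<inter> fst (subquadrangle_of perp Y)) = 6}\<rparr>"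

end

theory Submission
  imports Defs "HOL-Library.Sublist"
begin

text \<open>The elliptic ovoids of the symplectic subquadrangles are the sets of five points spanned by
  vectors \<open>v\<^sub>0, \<dots>, v\<^sub>4\<close> with sum 0 such that \<open>h v\<^sub>i v\<^sub>i = 0\<close> and \<open>h v\<^sub>i v\<^sub>j = 1\<close> for \<open>i \<noteq> j\<close>, where
  \<open>h\<close> is the Hermitian form; the points of the subquadrangle are spanned by the sums of one or two
  of these vectors. Four of the vectors form a basis, and in the coordinates with respect to it the
  form does not depend on the ovoid. Hence all ovoids look alike, and it suffices to enumerate the
  216 ovoids in coordinates and to count the common neighbours of one of them and each other one.\<close>

section \<open>Enumeration of the ovoids in coordinates\<close>

text \<open>The products become 1 as follows. Every elliptic quadric of PG(3,2) is, up to a linear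
  change of basis, the set of the four basis vectors and their sum. Its tangents are generators, so
  \<open>h\<close> vanishes between one vector of the ovoid and the sum of two others, and all
  products of two distinct vectors coincide. On the vectors of the Baer subgeometry \<open>h\<close>
  is a multiple of an alternating bilinear form, hence symmetric there, hence with values in the
  prime field; non-degeneracy leaves 1 as the common product. Three points need separate care. The
  graph refers to the subquadrangle of an ovoid by a definite description, so the spanning vectors
  must be unique up to a common scalar. The count needs some coordinate system to exist, which an
  orthonormal basis provides. And no transitive group is constructed: each ovoid is read in its own
  coordinates, where it is always the same list. The field is modelled by a datatype because the
  counts are proved by rewriting, which also explains the unusual shape of the list
  functions.\<close>

datatype f4 = F0 | F1 | Fw | Fv

fun f4_add :: "f4 \<Rightarrow> f4 \<Rightarrow> f4" where
  "f4_add F0 y = y" | "f4_add x F0 = x"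
| "f4_add F1 F1 = F0" | "f4_add F1 Fw = Fv" | "f4_add F1 Fv = Fw"
| "f4_add Fw F1 = Fv" | "f4_add Fw Fw = F0" | "f4_add Fw Fv = F1"
| "f4_add Fv F1 = Fw" | "f4_add Fv Fw = F1" | "f4_add Fv Fv = F0"

fun f4_mult :: "f4 \<Rightarrow> f4 \<Rightarrow> f4" where
  "f4_mult F0 y = F0" | "f4_mult x F0 = F0" | "f4_mult F1 y = y" | "f4_mult x F1 = x"
| "f4_mult Fw Fw = Fv" | "f4_mult Fw Fv = F1" | "f4_mult Fv Fw = F1" | "f4_mult Fv Fv = Fw"

fun f4_conj :: "f4 \<Rightarrow> f4" where
  "f4_conj F0 = F0" | "f4_conj F1 = F1" | "f4_conj Fw = Fv" | "f4_conj Fv = Fw"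

type_synonym f4_vec = "f4 \<times> f4 \<times> f4 \<times> f4"

fun vec_add :: "f4_vec \<Rightarrow> f4_vec \<Rightarrow> f4_vec" where
  "vec_add (a, b, c, d) (a', b', c', d') = (f4_add a a', f4_add b b', f4_add c c', f4_add d d')"

fun vec_scale :: "f4 \<Rightarrow> f4_vec \<Rightarrow> f4_vec" where
  "vec_scale k (a, b, c, d) = (f4_mult k a, f4_mult k b, f4_mult k c, f4_mult k d)"

fun vec_sum :: "f4_vec \<Rightarrow> f4" where
  "vec_sum (a, b, c, d) = f4_add a (f4_add b (f4_add c d))"

text \<open>In characteristic 2 this is the sum of \<open>x\<^sub>i * conj y\<^sub>j\<close> over all \<open>i \<noteq> j\<close>.\<close>

fun herm :: "f4_vec \<Rightarrow> f4_vec \<Rightarrow> f4" where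
  "herm (a, b, c, d) (a', b', c', d') =
     f4_add (f4_mult (vec_sum (a, b, c, d)) (f4_conj (vec_sum (a', b', c', d'))))
       (vec_sum (f4_mult a (f4_conj a'), f4_mult b (f4_conj b'),
          f4_mult c (f4_conj c'), f4_mult d (f4_conj d')))"

text \<open>The conjugate of a non-zero scalar is its inverse.\<close>

fun normalize_vec :: "f4_vec \<Rightarrow> f4_vec" where
  "normalize_vec (a, b, c, d) =
     vec_scale (f4_conj (if a \<noteq> F0 then a else if b \<noteq> F0 then b else if c \<noteq> F0 then c else d))
       (a, b, c, d)"

text \<open>Being in normal form means that the first non-zero coordinate is 1, so each point of the
  surface has one representative. The fixed order makes each set of points a unique subsequence of
  this list.\<close>

definition surface_points :: "f4_vec list" where
  "surface_points = filter (\<lambda>x. x \<noteq> (F0, F0, F0, F0) \<and> normalize_vec x = x \<and> herm x x = F0)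
     (let K = [F0, F1, Fw, Fv] in List.product K (List.product K (List.product K K)))"

text \<open>The usual equations of \<^const>\<open>filter\<close> involve a conditional, which makes the simplifier
  traverse the whole remaining list again after each step.\<close>

fun cons_if :: "bool \<Rightarrow> 'b \<Rightarrow> 'b list \<Rightarrow> 'b list" where
  "cons_if True x xs = x # xs" | "cons_if False x xs = xs"

fun sift :: "('b \<Rightarrow> bool) \<Rightarrow> 'b list \<Rightarrow> 'b list" where
  "sift P [] = []" | "sift P (x # xs) = cons_if (P x) x (sift P xs)"

lemma sift_eq_filter: "sift P xs = filter P xs"
proof (induction xs)
  case (Cons x xs)
  then show ?case by (cases "P x") simp_all
qed simp

text \<open>Backtracking: once \<open>x\<close> is chosen, only later entries related to
  \<open>x\<close> stay candidates.\<close>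

fun cliques :: "('b \<Rightarrow> 'b \<Rightarrow> bool) \<Rightarrow> nat \<Rightarrow> 'b list \<Rightarrow> 'b list list" where
  "cliques R 0 xs = [[]]"
| "cliques R (Suc k) [] = []"
| "cliques R (Suc k) (x # xs) =
     map (Cons x) (cliques R k (sift (R x) xs)) @ cliques R (Suc k) xs"

lemma subseq_filter_iff: "subseq ys (filter P xs) \<longleftrightarrow> subseq ys xs \<and> (\<forall>y\<in>set ys. P y)"
proof
  assume sub: "subseq ys (filter P xs)"
  then have "subseq ys xs"
    using subseq_filter_left subseq_order.trans by blast
  moreover have "P y" if "y \<in> set ys" for y
    using list_emb_set[OF sub that] by auto
  ultimately show "subseq ys xs \<and> (\<forall>y\<in>set ys. P y)" by blast
next
  assume "subseq ys xs \<and> (\<forall>y\<in>set ys. P y)"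
  then show "subseq ys (filter P xs)"
    by (metis filter_True subseq_filter)
qed

lemma cliques_iff:
  "ys \<in> set (cliques R k xs) \<longleftrightarrow> subseq ys xs \<and> length ys = k \<and> sorted_wrt R ys"
proof (induction R k xs arbitrary: ys rule: cliques.induct)
  case (3 R k x xs)
  show ?case
  proof (cases ys)
    case Nil
    then show ?thesis by (auto simp: 3)
  next
    case (Cons y zs)
    show ?thesis
    proof (cases "y = x")
      case True
      \<comment> \<open>Without distinctness the search in the tail may also return a list starting
        with \<open>x\<close>; its remainder then meets the conditions of the first search as
        well.\<close>
      have "x # zs \<in> set (cliques R (Suc k) xs) \<Longrightarrow> subseq zs xs \<and> length zs = k \<and> sorted_wrt R (x # zs)"
        using "3.IH"(2) by (auto dest: subseq_Cons')
      then show ?thesis using Cons True "3.IH" by (auto simp: sift_eq_filter subseq_filter_iff)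
    next
      case False
      then show ?thesis using Cons by (auto simp: 3 subseq_Cons2_neq)
    qed
  qed
qed auto

lemma distinct_cliques: "distinct xs \<Longrightarrow> distinct (cliques R k xs)"
proof (induction R k xs rule: cliques.induct)
  case (3 R k x xs)
  have "x # ys \<notin> set (cliques R (Suc k) xs)" for ys
    using 3(3) by (auto simp: cliques_iff dest: list_emb_set)
  then show ?case using 3 by (auto simp: distinct_map sift_eq_filter)
qed auto

text \<open>This triple product does not change when the vectors are rescaled, so it decides whether three
  isotropic points are spanned by vectors with pairwise products 1.\<close>

definition unit_triple :: "f4_vec \<Rightarrow> f4_vec \<Rightarrow> f4_vec \<Rightarrow> bool" where
  "unit_triple a b c \<longleftrightarrow> f4_mult (herm a b) (f4_mult (herm b c) (herm c a)) = F1"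

text \<open>The first entry serves as base point. Scaling every other \<open>y\<close> by
  \<open>herm x y\<close> makes its product with \<open>x\<close> equal to 1, and then the product
  of two scaled entries is exactly their triple product with \<open>x\<close>; so only triples
  through \<open>x\<close> are tested.\<close>

fun ovoid_lists :: "f4_vec list \<Rightarrow> f4_vec list list" where
  "ovoid_lists [] = []"
| "ovoid_lists (x # xs) =
     map (Cons x) (cliques (unit_triple x) 4 (sift (\<lambda>y. herm x y \<noteq> F0) xs)) @ ovoid_lists xs"

lemma ovoid_lists_iff:
  "l \<in> set (ovoid_lists xs) \<longleftrightarrow> subseq l xs \<and> length l = 5 \<and>
     (\<forall>y\<in>set (tl l). herm (hd l) y \<noteq> F0) \<and> sorted_wrt (unit_triple (hd l)) (tl l)"
proof (induction xs)
  case IH: (Cons x xs)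
  show ?case
  proof (cases l)
    case Nil
    then show ?thesis using IH by auto
  next
    case (Cons y zs)
    show ?thesis
    proof (cases "y = x")
      case True
      have "subseq (x # zs) xs \<Longrightarrow> subseq zs xs"
        by (rule subseq_Cons')
      then show ?thesis using Cons True IH by (auto simp: sift_eq_filter subseq_filter_iff cliques_iff)
    next
      case False
      then show ?thesis using Cons IH by (auto simp: subseq_Cons2_neq)
    qed
  qed
qed auto

lemma distinct_ovoid_lists: "distinct xs \<Longrightarrow> distinct (ovoid_lists xs)"
proof (induction xs)
  case (Cons x xs)
  have "x # ys \<notin> set (ovoid_lists xs)" for ys
    using Cons.prems by (auto simp: ovoid_lists_iff dest: list_emb_set)
  then show ?case using Cons by (auto simp: distinct_map distinct_cliques sift_eq_filter)
qed auto

fun rescale :: "f4_vec list \<Rightarrow> f4_vec list" where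
  "rescale [] = []"
| "rescale (x # xs) = x # map (\<lambda>y. vec_scale (herm x y) y) xs"

text \<open>The five rescaled vectors of an ovoid sum to 0, so a sum of three or four of them is
  also the sum of the other two or one. Five single vectors and ten pair sums therefore give all 15
  points of the subgeometry.\<close>

fun pair_sums :: "f4_vec list \<Rightarrow> f4_vec list" where
  "pair_sums [] = []" | "pair_sums (x # xs) = x # map (vec_add x) xs @ pair_sums xs"

definition quadrangle_list :: "f4_vec list \<Rightarrow> f4_vec list" where
  "quadrangle_list l = map normalize_vec (pair_sums (rescale l))"

text \<open>Nested conditionals instead of a conjunction, so that rewriting can decide at the first
  coordinate that differs.\<close>

fun same_vec :: "f4_vec \<Rightarrow> f4_vec \<Rightarrow> bool" where
  "same_vec (a, b, c, d) (a', b', c', d') \<longleftrightarrow>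
     (if a = a' then if b = b' then if c = c' then d = d' else False else False else False)"

fun elem :: "f4_vec \<Rightarrow> f4_vec list \<Rightarrow> bool" where
  "elem x [] \<longleftrightarrow> False" | "elem x (y # ys) \<longleftrightarrow> same_vec x y \<or> elem x ys"

lemma elem_iff: "elem x ys \<longleftrightarrow> x \<in> set ys"
proof -
  have "same_vec x y \<longleftrightarrow> x = y" for y by (cases x; cases y) simp
  then show ?thesis by (induction ys) simp_all
qed

text \<open>Pattern matching replaces a conditional for the same reason as in
  \<open>cons_if\<close>.\<close>

fun suc_if :: "bool \<Rightarrow> nat \<Rightarrow> nat" where
  "suc_if True n = Suc n" | "suc_if False n = n"

fun count_common :: "f4_vec list \<Rightarrow> f4_vec list \<Rightarrow> nat" where
  "count_common [] ys = 0" | "count_common (x # xs) ys = suc_if (elem x ys) (count_common xs ys)"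

lemma count_common_eq: "distinct xs \<Longrightarrow> count_common xs ys = card (set xs \<inter> set ys)"
proof (induction xs)
  case (Cons x xs)
  then show ?case by (cases "x \<in> set ys") (simp_all add: elem_iff)
qed simp

text \<open>The pattern matching makes evaluation skip the second count unless the first one is 1.\<close>

fun adj_test :: "nat \<Rightarrow> f4_vec list \<Rightarrow> f4_vec list \<Rightarrow> bool" where
  "adj_test 0 xs ys \<longleftrightarrow> False"
| "adj_test (Suc 0) xs ys \<longleftrightarrow> count_common xs ys = 6"
| "adj_test (Suc (Suc n)) xs ys \<longleftrightarrow> False"

lemma adj_test_iff: "adj_test n xs ys \<longleftrightarrow> n = 1 \<and> count_common xs ys = 6"
  by (cases "(n, xs, ys)" rule: adj_test.cases) simp_all

type_synonym ovoid_data = "f4_vec list \<times> f4_vec list"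

text \<open>The points of the subquadrangle are stored with the ovoid, to be computed once per ovoid
  and not once per pair. Selecting them from the list of surface points yields a distinct list, as
  \<open>count_common_eq\<close> demands.\<close>

definition ovoid_code_in :: "f4_vec list \<Rightarrow> f4_vec list \<Rightarrow> ovoid_data" where
  "ovoid_code_in ps l = (l, sift (\<lambda>x. elem x (quadrangle_list l)) ps)"

abbreviation ovoid_code :: "f4_vec list \<Rightarrow> ovoid_data" where
  "ovoid_code \<equiv> ovoid_code_in surface_points"

fun adj_code :: "ovoid_data \<Rightarrow> ovoid_data \<Rightarrow> bool" where
  "adj_code (a, b) (c, d) \<longleftrightarrow> adj_test (count_common a c) b d"

text \<open>The four coordinate vectors and their sum, in the order of \<open>surface_points\<close>
  because the enumeration consists of subsequences.\<close>

definition ovoid0 :: "f4_vec list" where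
  "ovoid0 = [(F0,F0,F0,F1), (F0,F0,F1,F0), (F0,F1,F0,F0), (F1,F0,F0,F0), (F1,F1,F1,F1)]"

text \<open>With the neighbours \<open>nbs\<close> as an argument, evaluation computes them only
  once, and common neighbours are sought among 40 candidates instead of 216. The first disjunct
  exempts the base vertex itself.\<close>

definition check_common :: "ovoid_data \<Rightarrow> ovoid_data list \<Rightarrow> ovoid_data list \<Rightarrow> bool" where
  "check_common x nbs ys \<longleftrightarrow> length nbs = 40 \<and>
     list_all (\<lambda>y. fst y = fst x \<or>
       length (sift (adj_code y) nbs) = (if adj_code x y then 4 else 8)) ys"

definition check_from :: "ovoid_data \<Rightarrow> ovoid_data list \<Rightarrow> bool" where
  "check_from x ys \<longleftrightarrow> check_common x (sift (adj_code x) ys) ys"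

text \<open>The points are an argument here, so that evaluation computes them only once.\<close>

definition check_ovoids :: "f4_vec list \<Rightarrow> bool" where
  "check_ovoids ps \<longleftrightarrow> check_from (ovoid_code_in ps ovoid0) (map (ovoid_code_in ps) (ovoid_lists ps))"

lemma length_ovoid_lists: "length (ovoid_lists surface_points) = 216"
  by code_simp

text \<open>This compares a single base vertex with all 216. Later
  \<open>frame_points_ovoid0\<close> lets every vertex take the role of the base vertex.\<close>

lemma check_ovoids: "check_ovoids surface_points"
  by code_simp

lemmas check_from_ovoid0 = check_ovoids[unfolded check_ovoids_def]

section \<open>Frames of the binary space\<close>

text \<open>Adding 1 permutes the field, so comparing the sums of all elements gives 4 = 0, that is,
  the square of 1 + 1 vanishes. Any \<open>w\<close> outside the prime field then yields the fourth
  element 1 + w, and \<open>w * w\<close> can only be that one: the value 1 would make the square of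
  1 + w zero.\<close>

lemma card_four_field:
  assumes "CARD('a::{field,finite}) = 4"
  obtains w :: "'a::{field,finite}" where "(1::'a) + 1 = 0" "w \<noteq> 0" "w \<noteq> 1" "w * w = 1 + w" "UNIV = {0, 1, w, 1 + w}"
proof -
  have "(\<Sum>x\<in>UNIV. x + 1) = (\<Sum>x\<in>UNIV. x::'a)"
    by (rule sum.reindex_bij_witness[of _ "\<lambda>x. x - 1" "\<lambda>x. x + 1"]) auto
  then have "of_nat 4 = (0::'a)" using assms by (simp add: sum.distrib)
  moreover have "of_nat 4 = ((1::'a) + 1) * (1 + 1)" by simp
  ultimately have two: "(1::'a) + 1 = 0" by (metis mult_eq_0_iff)
  have "\<not> (UNIV::'a set) \<subseteq> {0, 1}"
    using card_mono[of "{0::'a, 1}" UNIV] assms by auto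
  then obtain w :: 'a where w: "w \<noteq> 0" "w \<noteq> 1" by auto
  have w1: "1 + w \<noteq> 0" "1 + w \<noteq> 1" "1 + w \<noteq> w"
    using two w by (metis add_left_cancel add.commute add.left_neutral add.right_neutral zero_neq_one)+
  have "card {0, 1, w, 1 + w} = 4" using w w1 by auto
  then have U: "UNIV = {0, 1, w, 1 + w}"
    using assms by (metis card_subset_eq finite subset_UNIV)
  have "w * w \<noteq> 0" "w * w \<noteq> w" using w by auto
  moreover have "w * w \<noteq> 1"
  proof
    assume "w * w = 1"
    moreover have "(1 + w) * (1 + w) = (1 + 1) * w + (1 + w * w)" by (simp add: algebra_simps)
    ultimately show False using two w1 by simp
  qed
  moreover have "w * w \<in> {0, 1, w, 1 + w}" using U by blast
  ultimately show ?thesis using that two w U by blast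
qed

abbreviation pt :: "'a::field ^ 4 \<Rightarrow> ('a ^ 4) set" where
  "pt v \<equiv> vec.span {v}"

lemma in_pt_iff: "u \<in> pt v \<longleftrightarrow> (\<exists>c. u = c *s v)"
  by (auto simp: vec.span_singleton)

lemma pt_eq_iff:
  assumes "v \<noteq> 0"
  shows "pt u = pt v \<longleftrightarrow> (\<exists>c. c \<noteq> 0 \<and> u = c *s v)"
proof
  assume eq: "pt u = pt v"
  then have "u \<in> pt v" "v \<in> pt u" using vec.span_base by blast+
  then show "\<exists>c. c \<noteq> 0 \<and> u = c *s v" using assms unfolding in_pt_iff by (metis vec.scale_eq_0_iff)
next
  assume "\<exists>c. c \<noteq> 0 \<and> u = c *s v"
  then obtain c where c: "c \<noteq> 0" "u = c *s v" by blast
  then have "v = inverse c *s u" by simp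
  with c have "u \<in> pt v" "v \<in> pt u" unfolding in_pt_iff by blast+
  then show "pt u = pt v" by (simp add: vec.span_eq)
qed

lemma pg_points_eq: "pg_points = pt ` (- {0})"
proof -
  have "\<exists>v. v \<noteq> 0 \<and> U = pt v" if U: "vec.subspace U" "vec.dim U = 1" for U :: "('a::field ^ 4) set"
  proof -
    obtain B where B: "B \<subseteq> U" "vec.independent B" "U \<subseteq> vec.span B" "card B = 1"
      using vec.basis_exists[of U] U by metis
    then obtain v where v: "B = {v}" using card_1_singletonE by blast
    then have "U = pt v" using B U by (metis subset_antisym vec.span_minimal)
    moreover have "v \<noteq> 0" using B v vec.dependent_single by blast
    ultimately show ?thesis by blast
  qed
  moreover have "vec.dim (pt v) = 1" if "v \<noteq> 0" for v :: "'a ^ 4"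
    using vec.dim_span_eq_card_independent[of "{v}"] that by (simp add: vec.dependent_single)
  ultimately show ?thesis unfolding pg_points_def by (auto simp: image_iff)
qed

lemma ex_bit: "(\<exists>c::bit. P c) \<longleftrightarrow> P 0 \<or> P 1"
  by (metis bit.exhaust)

lemma bit_vec_add_self [simp]: "x + x = (0 :: bit ^ 4)"
  by (simp add: vec_eq_iff)

lemma bit_vec_add_eq_0_iff: "x + y = 0 \<longleftrightarrow> x = (y :: bit ^ 4)"
  by (metis add.right_neutral add_left_cancel bit_vec_add_self)

lemma bit_pt_eq: "pt (x :: bit ^ 4) = {0, x}"
proof -
  have "u \<in> pt x \<longleftrightarrow> u \<in> {0, x}" for u
    unfolding in_pt_iff by (simp add: ex_bit)
  then show ?thesis by blast
qed

definition bit_line :: "bit ^ 4 \<Rightarrow> bit ^ 4 \<Rightarrow> (bit ^ 4) set" where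
  "bit_line p q = {0, p, q, p + q}"

lemma span_bit_pair: "vec.span {p, q} = bit_line p q"
proof -
  have "u \<in> vec.span {p, q} \<longleftrightarrow> u \<in> bit_line p q" for u
  proof -
    have "u \<in> vec.span {p, q} \<longleftrightarrow> (\<exists>k. u - k *s p \<in> pt q)"
      using vec.span_breakdown_eq[of u p "{q}"] by simp
    also have "\<dots> \<longleftrightarrow> u \<in> pt q \<or> u - p \<in> pt q"
      by (simp add: ex_bit)
    also have "\<dots> \<longleftrightarrow> u \<in> bit_line p q"
      unfolding bit_pt_eq bit_line_def by (simp add: diff_eq_eq add.commute) blast
    finally show ?thesis .
  qed
  then show ?thesis by blast
qed

lemma independent_bit_pair:
  assumes "p \<noteq> 0" "q \<noteq> 0" "p \<noteq> (q :: bit ^ 4)"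
  shows "vec.independent {p, q}"
  using assms vec.independent_insert[of p "{q}"] by (auto simp: bit_pt_eq vec.dependent_single)

lemma pg_lines_bit: "pg_lines = {bit_line p q |p q. p \<noteq> 0 \<and> q \<noteq> 0 \<and> p \<noteq> q}"
proof -
  have A: "\<exists>p q. U = bit_line p q \<and> p \<noteq> 0 \<and> q \<noteq> 0 \<and> p \<noteq> q"
    if U: "vec.subspace U" "vec.dim U = 2" for U :: "(bit ^ 4) set"
  proof -
    obtain B where B: "B \<subseteq> U" "vec.independent B" "U \<subseteq> vec.span B" "card B = 2"
      using vec.basis_exists[of U] U by metis
    then obtain p q where pq: "B = {p, q}" "p \<noteq> q" by (meson card_2_iff)
    then have "U = bit_line p q" using B U by (metis subset_antisym vec.span_minimal span_bit_pair)
    moreover have "0 \<notin> B" using B vec.dependent_zero by blast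
    ultimately show ?thesis using pq by blast
  qed
  have B: "vec.subspace (bit_line p q) \<and> vec.dim (bit_line p q) = 2"
    if "p \<noteq> 0" "q \<noteq> 0" "p \<noteq> q" for p q :: "bit ^ 4"
    using vec.dim_span_eq_card_independent[OF independent_bit_pair[OF that]] that
    by (metis card_2_iff span_bit_pair vec.subspace_span)
  show ?thesis unfolding pg_lines_def
  proof (rule set_eqI, unfold mem_Collect_eq, rule iffI)
    fix U :: "(bit ^ 4) set"
    assume "vec.subspace U \<and> vec.dim U = 2"
    then show "\<exists>p q. U = bit_line p q \<and> p \<noteq> 0 \<and> q \<noteq> 0 \<and> p \<noteq> q" using A by simp
  next
    fix U :: "(bit ^ 4) set"
    assume "\<exists>p q. U = bit_line p q \<and> p \<noteq> 0 \<and> q \<noteq> 0 \<and> p \<noteq> q"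
    then obtain p q where "U = bit_line p q" "p \<noteq> 0" "q \<noteq> 0" "p \<noteq> q" by (elim exE conjE)
    then show "vec.subspace U \<and> vec.dim U = 2" using B by simp
  qed
qed

lemma points_on_bit_line:
  assumes "p \<noteq> 0" "q \<noteq> 0" "p \<noteq> q"
  shows "points_on (bit_line p q) = pt ` {p, q, p + q}"
proof -
  have "p + q \<noteq> 0" using assms by (simp add: bit_vec_add_eq_0_iff)
  then show ?thesis using assms
    unfolding points_on_def pg_points_eq by (auto simp: bit_pt_eq bit_line_def)
qed

text \<open>The bilinear form with matrix J - I, where J is the all-one matrix: isotropic basis
  vectors with pairwise products 1.\<close>

definition jform :: "'b::field ^ 4 \<Rightarrow> 'b ^ 4 \<Rightarrow> 'b" where
  "jform x y = x$1 * (y$2 + y$3 + y$4) + x$2 * (y$1 + y$3 + y$4) +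
     x$3 * (y$1 + y$2 + y$4) + x$4 * (y$1 + y$2 + y$3)"

lemma jform_add_left: "jform (x + y) z = jform x z + jform y z"
  and jform_add_right: "jform x (y + z) = jform x y + jform x z"
  and jform_scale_left: "jform (c *s x) y = c * jform x y"
  and jform_scale_right: "jform x (c *s y) = c * jform x y"
  and jform_commute: "jform x y = jform y x"
  by (simp_all add: jform_def algebra_simps)

lemma jform_self:
  fixes x :: "'b::field ^ 4"
  assumes "(1::'b) + 1 = 0"
  shows "jform x x = 0"
proof -
  have "jform x x = (1 + 1) * (x$1 * (x$2 + x$3 + x$4) + x$2 * (x$3 + x$4) + x$3 * x$4)"
    by (simp add: jform_def algebra_simps)
  then show ?thesis using assms by simp
qed

lemma jform_axis:
  "jform x (axis 1 1) = x$2 + x$3 + x$4" "jform x (axis 2 1) = x$1 + x$3 + x$4"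
  "jform x (axis 3 1) = x$1 + x$2 + x$4" "jform x (axis 4 1) = x$1 + x$2 + x$3"
  by (simp_all add: jform_def axis_def)

lemma jform_nondegenerate:
  fixes x :: "'b::field ^ 4"
  assumes two: "(1::'b) + 1 = 0" and zero: "\<And>y. jform x y = 0"
  shows "x = 0"
proof -
  have z: "x$2 + x$3 + x$4 = 0" "x$1 + x$3 + x$4 = 0" "x$1 + x$2 + x$4 = 0" "x$1 + x$2 + x$3 = 0"
    using zero jform_axis by metis+
  have eq: "x$1 = x$2" "x$1 = x$3" "x$1 = x$4" using z by algebra+
  then have "x$1 * (1 + 1) + x$1 = 0" using z by (simp add: algebra_simps)
  then have "x$1 = 0" by (simp only: two mult_zero_right add_0)
  then show ?thesis using eq by (simp add: vec_eq_iff forall_4)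
qed

text \<open>The second elementary symmetric polynomial. On a vector with n ones its value is the
  parity of n(n-1)/2, so its non-trivial zeros have weight 1 or 4, and its polarization is
  \<open>jform\<close>.\<close>

definition frame_form :: "bit ^ 4 \<Rightarrow> bit" where
  "frame_form x = x$1 * x$2 + x$1 * x$3 + x$1 * x$4 + x$2 * x$3 + x$2 * x$4 + x$3 * x$4"

definition frame :: "(bit ^ 4) set" where
  "frame = {x. x \<noteq> 0 \<and> frame_form x = 0}"

lemma polar_frame_form: "polar_form frame_form = jform"
proof (intro ext)
  fix x y :: "bit ^ 4"
  show "polar_form frame_form x y = jform x y"
    unfolding polar_form_def frame_form_def jform_def minus_bit_def
    by (cases "x$1"; cases "x$2"; cases "x$3"; cases "x$4";
        cases "y$1"; cases "y$2"; cases "y$3"; cases "y$4") simp_all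
qed

lemma frame_form_add: "frame_form (x + y) = frame_form x + frame_form y + jform x y"
proof -
  have "jform x y = frame_form (x + y) + frame_form x + frame_form y"
    using fun_cong[OF fun_cong[OF polar_frame_form], of x y] by (simp add: polar_form_def)
  then show ?thesis by (cases "frame_form x"; cases "frame_form y"; cases "frame_form (x + y)") simp_all
qed

lemma frame_eq: "frame = {axis 1 1, axis 2 1, axis 3 1, axis 4 1, 1}"
proof -
  have "x \<in> frame \<longleftrightarrow> x \<in> {axis 1 1, axis 2 1, axis 3 1, axis 4 1, 1}" for x
    unfolding frame_def frame_form_def
    by (cases "x$1"; cases "x$2"; cases "x$3"; cases "x$4")
       (simp_all add: vec_eq_iff forall_4 axis_def)
  then show ?thesis by blast
qed

lemma jform_frame:
  assumes "x \<in> frame" "y \<in> frame" "x \<noteq> y"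
  shows "jform x y = 1"
  using assms unfolding frame_eq
  by (elim insertE emptyE) (simp_all add: jform_def axis_def)

lemma card_frame: "card frame = 5"
  unfolding frame_eq by (simp add: vec_eq_iff forall_4 axis_def)

text \<open>Each pair among the three vectors contributes 1 to \<open>frame_form\<close>, giving 1
  for two vectors and 3 = 1 for three. Thus the line through \<open>x\<close> and
  \<open>y + z\<close> is tangent to the frame at \<open>x\<close>; these are the tangents from
  which the Gram matrix is derived.\<close>

lemma frame_sum3:
  assumes "x \<in> frame" "y \<in> frame" "z \<in> frame" "x \<noteq> y" "x \<noteq> z" "y \<noteq> z"
  shows "y + z \<notin> frame" "x + y + z \<notin> frame"
proof -
  have "frame_form (y + z) = 1" "frame_form (x + y + z) = 1"
    using assms jform_frame[of x y] jform_frame[of x z] jform_frame[of y z]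
    by (simp_all add: frame_form_add jform_add_left frame_def)
  then show "y + z \<notin> frame" "x + y + z \<notin> frame" by (simp_all add: frame_def)
qed

section \<open>The field with four elements and its Baer subgeometries\<close>

locale four_field =
  fixes w :: "'a::{field,finite}"
  assumes two: "(1::'a) + 1 = 0" and w_nz: "w \<noteq> 0" "w \<noteq> 1" and w_sq: "w * w = 1 + w"
    and UNIV_w: "UNIV = {0, 1, w, 1 + w}"
begin

lemma two_eq_0 [simp]: "(2::'a) = 0"
  using two by simp

lemma add_self [simp]: "x + x = (0::'a)"
proof -
  have "x + x = (1 + 1) * x" by (simp only: distrib_right mult_1)
  then show ?thesis using two by simp
qed

lemma uminus_eq [simp]: "- x = (x::'a)"
  by (metis add_self minus_unique)

lemma minus_eq [simp]: "x - y = x + (y::'a)"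
  by (metis diff_conv_add_uminus uminus_eq)

lemma vec_add_self [simp]: "x + x = (0 :: 'a ^ 4)"
  by (simp only: vec_eq_iff vector_add_component add_self zero_index simp_thms)

lemma vec_add_eq_0_iff: "x + y = 0 \<longleftrightarrow> x = (y :: 'a ^ 4)"
  by (metis add.right_neutral add_left_cancel vec_add_self)

lemma add_self_left [simp]: "x + (x + y) = (y::'a)"
  by (metis add.assoc add_self add_0)

lemma one_add_w: "1 + w \<noteq> 0" "1 + w \<noteq> 1" "1 + w \<noteq> w"
proof -
  show "1 + w \<noteq> 0" using w_nz by (metis add_self_left add.right_neutral)
  show "1 + w \<noteq> 1" "1 + w \<noteq> w" using w_nz by simp_all
qed

lemma field_cases: obtains "x = 0" | "x = 1" | "x = w" | "x = 1 + w"
  using UNIV_w by blast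

lemma field_mult: "w * (1 + w) = 1" "(1 + w) * w = 1" "(1 + w) * (1 + w) = w"
  using w_sq by (simp_all add: algebra_simps)

lemma cube: "x \<noteq> 0 \<Longrightarrow> x * x\<^sup>2 = (1::'a)"
  by (cases x rule: field_cases) (simp_all add: power2_eq_square w_sq field_mult)

lemma sq_sq [simp]: "(x\<^sup>2)\<^sup>2 = (x::'a)"
  by (cases x rule: field_cases) (simp_all add: power2_eq_square w_sq field_mult)

lemma sq_add: "(x + y)\<^sup>2 = x\<^sup>2 + (y::'a)\<^sup>2"
  by (simp add: power2_eq_square algebra_simps)

lemma sq_eq_self_iff: "x\<^sup>2 = x \<longleftrightarrow> x = 0 \<or> x = (1::'a)"
  by (simp add: power2_eq_square)

definition bit_vec :: "bit ^ 4 \<Rightarrow> 'a ^ 4" where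
  "bit_vec x = (\<chi> i. of_bit (x$i))"

lemma baer_vec_eq: "baer_vec M x = M *v bit_vec x"
  by (simp add: baer_vec_def bit_vec_def)

lemma of_bit_add: "(of_bit (a + b) :: 'a) = of_bit a + of_bit b"
  by (cases a; cases b) simp_all

lemma of_bit_mult: "(of_bit (a * b) :: 'a) = of_bit a * of_bit b"
  by (cases a; cases b) simp_all

lemma bit_vec_add: "bit_vec (x + y) = bit_vec x + bit_vec y"
  by (simp only: bit_vec_def vec_eq_iff vec_lambda_beta vector_add_component of_bit_add simp_thms)

lemma bit_vec_0 [simp]: "bit_vec 0 = 0"
  by (simp add: bit_vec_def vec_eq_iff)

lemma baer_vec_add: "baer_vec M (x + y) = baer_vec M x + (baer_vec M y :: 'a ^ 4)"
  by (simp add: baer_vec_eq bit_vec_add matrix_vector_right_distrib)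

lemma baer_vec_0 [simp]: "baer_vec M 0 = (0 :: 'a ^ 4)"
  by (simp add: baer_vec_eq)

lemma jform_bit_vec: "jform (bit_vec x) (bit_vec y) = of_bit (jform x y)"
  by (simp only: jform_def bit_vec_def vec_lambda_beta of_bit_add of_bit_mult)

lemma bit_pair_eq_0: "(of_bit p :: 'a) + w * of_bit q = 0 \<Longrightarrow> p = 0 \<and> q = 0"
  using w_nz one_add_w by (cases p; cases q) simp_all

text \<open>The scalars 1 and \<open>w\<close> form a basis of the field over its prime field. This
  splitting reduces statements about all vectors to binary ones.\<close>

lemma bit_vec_decompose:
  obtains a b where "y = bit_vec a + w *s bit_vec b"
proof -
  let ?a = "(\<chi> i. if y$i = 1 \<or> y$i = 1 + w then 1 else 0) :: bit ^ 4"
  let ?b = "(\<chi> i. if y$i = w \<or> y$i = 1 + w then 1 else 0) :: bit ^ 4"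
  have "y$i = (bit_vec ?a + w *s bit_vec ?b)$i" for i
    using w_nz one_add_w by (cases "y$i" rule: field_cases) (simp_all add: bit_vec_def)
  then have "y = bit_vec ?a + w *s bit_vec ?b" unfolding vec_eq_iff by blast
  then show ?thesis using that by blast
qed

text \<open>In a coordinate where the two binary vectors differ, one entry is 0 and the other 1,
  which kills one coefficient; a non-zero entry of the remaining vector kills the other.\<close>

lemma bit_vec_independent:
  assumes "x \<noteq> 0" "y \<noteq> 0" "x \<noteq> y" "a *s bit_vec x + b *s bit_vec y = 0"
  shows "a = 0 \<and> b = 0"
proof -
  have eq: "a * of_bit (x$i) + b * of_bit (y$i) = 0" for i
    using assms(4) by (simp add: bit_vec_def vec_eq_iff)
  have nz: "\<exists>i. z$i = 1" if "z \<noteq> 0" for z :: "bit ^ 4"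
    using that by (auto simp: vec_eq_iff)
  obtain i where i: "x$i \<noteq> y$i" using assms(3) by (auto simp: vec_eq_iff)
  show ?thesis
  proof (cases "x$i = 0")
    case True
    then have "b = 0" using i eq[of i] by simp
    moreover obtain j where "x$j = 1" using nz assms(1) by blast
    ultimately show ?thesis using eq[of j] by simp
  next
    case False
    then have "a = 0" using i eq[of i] by simp
    moreover obtain j where "y$j = 1" using nz assms(2) by blast
    ultimately show ?thesis using eq[of j] by simp
  qed
qed

lemma invertible_mult_eq_0:
  fixes M :: "'a ^ 4 ^ 4"
  assumes "invertible M" "M *v x = 0"
  shows "x = 0"
  using assms matrix_left_invertible_ker invertible_def by blast

lemma baer_vec_independent:
  fixes M :: "'a ^ 4 ^ 4"
  assumes "invertible M" "x \<noteq> 0" "y \<noteq> 0" "x \<noteq> y" "a *s baer_vec M x + b *s baer_vec M y = 0"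
  shows "a = 0 \<and> b = 0"
proof -
  have "M *v (a *s bit_vec x + b *s bit_vec y) = 0"
    using assms(5) by (simp add: baer_vec_eq matrix_vector_right_distrib vector_scalar_commute)
  then show ?thesis using invertible_mult_eq_0 bit_vec_independent assms by blast
qed

lemma baer_vec_nonzero:
  fixes M :: "'a ^ 4 ^ 4"
  assumes "invertible M" "x \<noteq> 0"
  shows "baer_vec M x \<noteq> (0 :: 'a ^ 4)"
proof
  assume "baer_vec M x = 0"
  then have "bit_vec x = 0" using invertible_mult_eq_0[OF assms(1)] by (simp add: baer_vec_eq)
  then show False using assms(2) by (auto simp: bit_vec_def vec_eq_iff)
qed

lemma pt_baer_vec_eq_iff:
  fixes M :: "'a ^ 4 ^ 4"
  assumes "invertible M" "x \<noteq> 0" "y \<noteq> 0"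
  shows "pt (baer_vec M x) = pt (baer_vec M y) \<longleftrightarrow> x = y"
proof
  assume "pt (baer_vec M x) = pt (baer_vec M y)"
  then obtain c where "baer_vec M x = c *s baer_vec M y"
    using pt_eq_iff[OF baer_vec_nonzero[OF assms(1,3)]] by blast
  then have "1 *s baer_vec M x + c *s baer_vec M y = 0" by simp
  then show "x = y" using baer_vec_independent[OF assms, of 1 c] by auto
qed simp

lemma baer_ext_pt: "baer_ext M (pt x) = pt (baer_vec M x :: 'a ^ 4)"
  by (simp add: baer_ext_def bit_pt_eq)

definition line3 :: "'a ^ 4 \<Rightarrow> 'a ^ 4 \<Rightarrow> ('a ^ 4) set set" where
  "line3 u v = pt ` {u, v, u + v}"

text \<open>Points and lines of a subgeometry expressed by its set of vectors alone. Two matrices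
  are then compared through the ranges of their \<open>baer_vec\<close> maps.\<close>

definition span_points :: "('a ^ 4) set \<Rightarrow> ('a ^ 4) set set" where
  "span_points B = pt ` (B - {0})"

definition span_lines :: "('a ^ 4) set \<Rightarrow> ('a ^ 4) set set set" where
  "span_lines B = {line3 u v |u v. u \<in> B - {0} \<and> v \<in> B - {0} \<and> u \<noteq> v}"

lemma span_linesI: "\<lbrakk>u \<in> B; v \<in> B; u \<noteq> 0; v \<noteq> 0; u \<noteq> v\<rbrakk> \<Longrightarrow> line3 u v \<in> span_lines B"
  unfolding span_lines_def by blast

lemma span_linesE:
  assumes "l \<in> span_lines B"
  obtains u v where "u \<in> B" "v \<in> B" "u \<noteq> 0" "v \<noteq> 0" "u \<noteq> v" "l = line3 u v"
  using assms unfolding span_lines_def by blast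

lemma baer_points_eq:
  fixes M :: "'a ^ 4 ^ 4"
  assumes "invertible M"
  shows "baer_points M = span_points (range (baer_vec M))"
proof -
  have "range (baer_vec M) - {0} = baer_vec M ` (- {0})"
    using baer_vec_nonzero[OF assms] by auto
  then show ?thesis
    by (simp add: baer_points_def span_points_def pg_points_eq image_image baer_ext_pt)
qed

lemma baer_line_eq:
  assumes "p \<noteq> 0" "q \<noteq> 0" "p \<noteq> q"
  shows "baer_line M (bit_line p q) = line3 (baer_vec M p) (baer_vec M q)"
  by (simp add: baer_line_def points_on_bit_line[OF assms] baer_ext_pt line3_def baer_vec_add)

lemma baer_vec_eq_iff:
  fixes M :: "'a ^ 4 ^ 4"
  assumes "invertible M"
  shows "baer_vec M x = (baer_vec M y :: 'a ^ 4) \<longleftrightarrow> x = y"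
proof
  assume "baer_vec M x = baer_vec M y"
  then have "baer_vec M (x + y) = 0" by (simp add: baer_vec_add)
  then show "x = y" using baer_vec_nonzero[OF assms] bit_vec_add_eq_0_iff by blast
qed simp

lemma baer_lines_eq:
  fixes M :: "'a ^ 4 ^ 4"
  assumes "invertible M"
  shows "baer_lines M = span_lines (range (baer_vec M))"
proof (intro equalityI subsetI)
  fix l assume "l \<in> baer_lines M"
  then obtain p q where pq: "l = baer_line M (bit_line p q)" "p \<noteq> 0" "q \<noteq> 0" "p \<noteq> q"
    by (auto simp: baer_lines_def pg_lines_bit)
  show "l \<in> span_lines (range (baer_vec M))"
    unfolding pq(1) baer_line_eq[OF pq(2-4)]
    by (rule span_linesI) (use pq baer_vec_nonzero[OF assms] baer_vec_eq_iff[OF assms] in simp_all)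
next
  fix l assume "l \<in> span_lines (range (baer_vec M))"
  then obtain u v where uv: "u \<in> range (baer_vec M)" "v \<in> range (baer_vec M)" "u \<noteq> 0" "v \<noteq> 0"
      "u \<noteq> v" "l = line3 u v"
    by (rule span_linesE)
  then obtain p q where pq: "u = baer_vec M p" "v = baer_vec M q" by blast
  then have nz: "p \<noteq> 0" "q \<noteq> 0" "p \<noteq> q" using uv by auto
  then have "l = baer_line M (bit_line p q)" using baer_line_eq pq uv by simp
  then show "l \<in> baer_lines M" using nz by (auto simp: baer_lines_def pg_lines_bit)
qed

definition frame_points :: "'a ^ 4 ^ 4 \<Rightarrow> ('a ^ 4) set set" where
  "frame_points M = (\<lambda>x. pt (baer_vec M x)) ` frame"

end

section \<open>Ovoids as frames\<close>

lemma linear_form_iff: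
  fixes f :: "'b::field ^ 4 \<Rightarrow> 'b"
  shows "Vector_Spaces.linear (*s) (*) f \<longleftrightarrow>
    (\<forall>x y. f (x + y) = f x + f y) \<and> (\<forall>c x. f (c *s x) = c * f x)"
  by (simp add: Vector_Spaces.linear_iff vec.vector_space_axioms
      vector_space_over_itself.vector_space_axioms)

lemma bilinear_formD:
  assumes "bilinear_form f"
  shows "f (x + y) z = f x z + f y z" "f x (y + z) = f x y + f x z"
    "f (c *s x) y = c * f x y" "f x (c *s y) = c * f x y"
  using assms by (simp_all add: bilinear_form_def linear_form_iff)

lemma not_spanned_by_3:
  fixes S :: "('b::field ^ 4) set"
  assumes "finite S" "card S \<le> 3"
  shows "vec.span S \<noteq> UNIV"
proof
  assume "vec.span S = UNIV"
  then have "vec.dim (UNIV :: ('b ^ 4) set) \<le> card S"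
    using vec.dim_le_card[of UNIV S] assms(1) by simp
  then show False using assms(2) by (simp add: vec_dim_card del: vec.dim_UNIV)
qed

lemma bit_vec_expand:
  "x = x$1 *s axis 1 1 + x$2 *s axis 2 1 + x$3 *s axis 3 1 + x$4 *s (axis 4 1 :: 'b::field ^ 4)"
  by (simp add: vec_eq_iff forall_4 axis_def)

text \<open>Over the prime field an additive map is already linear, so it is determined on a basis.
  The target is an arbitrary abelian group, which covers both vectors and scalars over the larger
  field.\<close>

lemma bit_vec_additive_eqI:
  fixes f g :: "bit ^ 4 \<Rightarrow> 'c::ab_group_add"
  assumes f: "\<And>x y. f (x + y) = f x + f y" and g: "\<And>x y. g (x + y) = g x + g y"
    and eq: "f (axis 1 1) = g (axis 1 1)" "f (axis 2 1) = g (axis 2 1)"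
      "f (axis 3 1) = g (axis 3 1)" "f (axis 4 1) = g (axis 4 1)"
  shows "f x = g x"
proof -
  have z: "f 0 = 0" "g 0 = 0" using f[of 0 0] g[of 0 0] by simp_all
  have s: "f (c *s y) = g (c *s y)" if "f y = g y" for c y
    using that z by (cases c) simp_all
  show ?thesis
    by (subst (1 2) bit_vec_expand) (simp only: f g s[OF eq(1)] s[OF eq(2)] s[OF eq(3)] s[OF eq(4)])
qed

lemma bit_vec_add_self_left [simp]: "x + (x + y) = (y :: bit ^ 4)"
  by (metis add.assoc add_0 bit_vec_add_self)

text \<open>Over the field with two elements an elliptic quadratic form is the orthogonal sum of a
  hyperbolic plane, spanned by singular vectors \<open>a\<close> and \<open>c\<close>, and an anisotropic plane, spanned by
  \<open>x\<close> and \<open>y\<close>. The singular vectors \<open>a\<close>, \<open>c\<close>, \<open>a + c + x\<close>, \<open>a + c + y\<close> form a frame together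
  with their sum.\<close>

lemma elliptic_quadric_frame:
  fixes E :: "(bit ^ 4) set set"
  assumes "elliptic_quadric E"
  obtains A :: "bit ^ 4 \<Rightarrow> bit ^ 4"
  where "\<And>x y. A (x + y) = A x + A y" "bij A" "E = pt ` A ` frame"
proof -
  obtain Q where Q: "quadratic_form Q" "nonsingular Q" "E = quadric Q"
    using assms by (auto simp: elliptic_quadric_def)
  define b where "b = polar_form Q"
  have bil: "bilinear_form b" using Q(1) by (simp add: quadratic_form_def b_def)
  note b_simps = bilinear_formD[OF bil]
  have Q_scale: "Q (c *s v) = c * Q v" for c v
  proof -
    have "Q (c *s v) = c\<^sup>2 * Q v" using Q(1) unfolding quadratic_form_def by blast
    moreover have "c\<^sup>2 = c" by (cases c) simp_all
    ultimately show ?thesis by simp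
  qed
  have Q_0: "Q 0 = 0" using Q_scale[of 0 0] by simp
  have Q_add: "Q (u + v) = Q u + Q v + b u v" for u v
    unfolding b_def polar_form_def by (cases "Q u"; cases "Q v"; cases "Q (u + v)") simp_all
  have b_self: "b v v = 0" for v
    using Q_add[of v v] Q_0 by (cases "Q v") simp_all
  have b_commute: "b u v = b v u" for u v
    using Q_add[of u v] Q_add[of v u] by (simp only: add.commute[of v u] add.commute[of "Q v"] add_left_cancel)
  have E_iff: "pt x \<in> E \<longleftrightarrow> Q x = 0" if "x \<noteq> 0" for x
    using that by (auto simp: Q(3) quadric_def pg_points_eq bit_pt_eq Q_0)
  have E_eq: "E = pt ` {x. x \<noteq> 0 \<and> Q x = 0}"
  proof (intro equalityI subsetI)
    fix P assume P: "P \<in> E"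
    then have "P \<in> pg_points" by (simp add: Q(3) quadric_def)
    then obtain x where "x \<noteq> 0" "P = pt x" unfolding pg_points_eq by blast
    then show "P \<in> pt ` {x. x \<noteq> 0 \<and> Q x = 0}" using P E_iff by blast
  qed (use E_iff in blast)
  \<comment> \<open>Two orthogonal singular points would span a line contained in the
    quadric.\<close>
  have no_line: False
    if "p \<noteq> 0" "q \<noteq> 0" "p \<noteq> q" "Q p = 0" "Q q = 0" "b p q = 0" for p q
  proof -
    have "p + q \<noteq> 0" "Q (p + q) = 0" using that by (simp_all add: bit_vec_add_eq_0_iff Q_add)
    then have "points_on (bit_line p q) \<subseteq> E"
      unfolding points_on_bit_line[OF that(1-3)] using that E_iff by simp
    moreover have "bit_line p q \<in> pg_lines" using that by (auto simp: pg_lines_bit)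
    ultimately show False using assms by (auto simp: elliptic_quadric_def)
  qed
  obtain a where a: "a \<noteq> 0" "Q a = 0" using E_eq assms by (auto simp: elliptic_quadric_def)
  obtain c0 where c0: "b a c0 = 1"
    using Q(2) a unfolding nonsingular_def b_def by (metis bit_not_zero_iff)
  \<comment> \<open>If \<open>Q c0 = 1\<close>, adding \<open>a\<close> repairs this:
    \<open>Q (c0 + a)\<close> is \<open>1 + 0 + b c0 a = 0\<close>, and the product with
    \<open>a\<close> stays 1.\<close>
  define c where "c = (if Q c0 = 0 then c0 else c0 + a)"
  have ac: "b a c = 1" using c0 by (simp add: c_def b_simps b_self)
  have Qc: "Q c = 0" using a c0 by (simp add: c_def Q_add b_commute[of c0])
  \<comment> \<open>The orthogonal complement of the hyperbolic plane of \<open>a\<close> and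
    \<open>c\<close>. It is anisotropic, since a singular vector in it would be orthogonal to
    \<open>a\<close>.\<close>
  define P where "P = {v. b v a = 0 \<and> b v c = 0}"
  have Q_P: "Q v = 1" if "v \<in> P" "v \<noteq> 0" for v
  proof (rule ccontr)
    assume "Q v \<noteq> 1"
    moreover have "a \<noteq> v" using that ac by (auto simp: P_def)
    ultimately show False using no_line[of a v] a that by (simp add: P_def b_commute[of a])
  qed
  have P_add: "u + v \<in> P" if "u \<in> P" "v \<in> P" for u v
    using that by (simp add: P_def b_simps)
  have proj: "v + b v c *s a + b v a *s c \<in> P" for v
    using ac by (simp add: P_def b_simps b_self b_commute[of c a] add.assoc)
  \<comment> \<open>Otherwise \<open>P\<close> contains at most one non-zero vector
    \<open>t\<close>, and by the projection onto \<open>P\<close> the three vectors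
    \<open>a\<close>, \<open>c\<close>, \<open>t\<close> would span the space.\<close>
  have "\<exists>x\<in>P. \<exists>y\<in>P. x \<noteq> 0 \<and> y \<noteq> 0 \<and> x \<noteq> y"
  proof (rule ccontr)
    assume neg: "\<not> ?thesis"
    obtain t where t: "P \<subseteq> {0, t}"
    proof (cases "P \<subseteq> {0}")
      case False
      then obtain t where "t \<in> P" "t \<noteq> 0" by blast
      then have "P \<subseteq> {0, t}" using neg by blast
      then show ?thesis using that by blast
    qed (use that in blast)
    have "v \<in> vec.span {a, c, t}" for v
    proof -
      define v' where "v' = v + b v c *s a + b v a *s c"
      have "v' \<in> vec.span {a, c, t}"
      proof -
        have "v' = 0 \<or> v' = t" using subsetD[OF t proj[of v]] by (simp add: v'_def)
        then show ?thesis by (auto intro: vec.span_zero vec.span_base)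
      qed
      moreover have "b v c *s a \<in> vec.span {a, c, t}" "b v a *s c \<in> vec.span {a, c, t}"
        by (simp_all add: vec.span_base vec.span_scale)
      moreover have "v = v' + b v a *s c + b v c *s a"
        by (simp add: v'_def add.assoc)
      ultimately show ?thesis by (metis vec.span_add)
    qed
    then have "vec.span {a, c, t} = UNIV" by blast
    moreover have "card {a, c, t} \<le> 3" by (simp add: card_insert_if)
    ultimately show False using not_spanned_by_3[of "{a, c, t}"] by simp
  qed
  then obtain x y where xy: "x \<in> P" "y \<in> P" "x \<noteq> 0" "y \<noteq> 0" "x \<noteq> y" by blast
  have Qx: "Q x = 1" "Q y = 1" "Q (x + y) = 1"
    using xy Q_P P_add by (simp_all add: bit_vec_add_eq_0_iff)
  have bxy: "b x y = 1" using Qx Q_add[of x y] by simp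
  have bP: "b x a = 0" "b x c = 0" "b y a = 0" "b y c = 0" "b a x = 0" "b c x = 0" "b a y = 0" "b c y = 0"
    using xy b_commute by (auto simp: P_def)
  note bs = b_simps b_self ac b_commute[of c a] bxy bP b_commute[of y x]
  \<comment> \<open>Singular, because \<open>a + c\<close> and \<open>x\<close> are orthogonal and
    \<open>Q\<close> is 1 on both.\<close>
  define p where "p = a + c + x"
  define q where "q = a + c + y"
  have Q_frame: "Q p = 0" "Q q = 0"
    by (simp_all add: p_def q_def Q_add bs a Qc Qx)
  have b_frame: "b a p = 1" "b a q = 1" "b c p = 1" "b c q = 1" "b p q = 1"
    by (simp_all add: p_def q_def bs)
  define A where "A z = z$1 *s a + z$2 *s c + z$3 *s p + z$4 *s q" for z :: "bit ^ 4"
  have A_add: "A (u + v) = A u + A v" for u v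
    by (simp only: A_def vector_add_component vec.scale_left_distrib ac_simps)
  have QA: "Q (A z) = frame_form z" for z
    unfolding A_def
    by (cases "z$1"; cases "z$2"; cases "z$3"; cases "z$4")
      (simp_all add: Q_add Q_0 b_simps ac a Qc Q_frame b_frame frame_form_def)
  have bA: "b (A u) (A v) = jform u v" for u v
    using Q_add[of "A u" "A v"] frame_form_add[of u v] unfolding A_add[symmetric] QA
    by (metis add_left_cancel)
  \<comment> \<open>By \<open>bA\<close> the map carries the non-degenerate form
    \<open>jform\<close> to \<open>b\<close>, so its kernel is trivial.\<close>
  have A_inj: "inj A"
  proof (rule injI)
    fix u v assume "A u = A v"
    then have "A (u + v) = 0" by (simp add: A_add)
    moreover have "b 0 z = 0" for z using b_simps(3)[of 0 0 z] by simp
    ultimately have "jform (u + v) z = 0" for z using bA[of "u + v" z] by simp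
    then show "u = v" using jform_nondegenerate[of "u + v"] bit_vec_add_eq_0_iff by simp
  qed
  moreover have "Vector_Spaces.linear (*s) (*s) A"
    unfolding Vector_Spaces.linear_iff
    by (simp add: vec.vector_space_axioms A_add) (simp add: A_def vec.scale_right_distrib)
  ultimately have "surj A" by (simp add: vec.linear_inj_imp_surj)
  have A_0: "A z = 0 \<longleftrightarrow> z = 0" for z
    using A_add[of 0 0] injD[OF A_inj, of z 0] by auto
  have "{x. x \<noteq> 0 \<and> Q x = 0} = A ` frame"
  proof (intro equalityI subsetI)
    fix v assume v: "v \<in> {x. x \<noteq> 0 \<and> Q x = 0}"
    obtain z where "v = A z" using \<open>surj A\<close> by blast
    then show "v \<in> A ` frame" using v A_0 QA by (auto simp: frame_def)
  qed (auto simp: frame_def A_0 QA)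
  then have "E = pt ` A ` frame" using E_eq by simp
  with A_add bijI[OF A_inj \<open>surj A\<close>] show ?thesis by (rule that)
qed

lemma invertibleI:
  fixes M :: "'b::field ^ 'n ^ 'n"
  assumes "\<And>x. M *v x = 0 \<Longrightarrow> x = 0"
  shows "invertible M"
  using assms matrix_left_invertible_ker[of M] matrix_left_right_inverse unfolding invertible_def
  by metis

lemma invertible_surj:
  fixes M :: "'b::field ^ 'n ^ 'n"
  assumes "invertible M"
  obtains x where "v = M *v x"
  using assms matrix_right_invertible_surjective[of M] unfolding invertible_def surj_def by metis

context four_field
begin

lemma power4_eq [simp]: "(x::'a) ^ 4 = x"
  using sq_sq[of x] by simp

lemma bit_vec_decompose_eq_0:
  assumes "bit_vec a + w *s bit_vec b = 0"
  shows "a = 0 \<and> b = 0"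
proof -
  have "of_bit (a$i) + w * of_bit (b$i) = 0" for i
    using assms by (simp add: bit_vec_def vec_eq_iff)
  then have "a$i = 0 \<and> b$i = 0" for i by (rule bit_pair_eq_0)
  then show ?thesis by (simp add: vec_eq_iff)
qed

lemma baer_vec_axis: "baer_vec M (axis j 1) = (column j M :: 'a ^ 4)"
proof -
  have "bit_vec (axis j 1) = axis j 1" by (simp add: bit_vec_def vec_eq_iff axis_def)
  moreover have "M *v axis j 1 = column j M"
    by (simp add: matrix_mult_sum axis_def vec_eq_iff if_distrib[of "\<lambda>c. c * _"] cong: if_cong)
  ultimately show ?thesis by (simp add: baer_vec_eq)
qed

text \<open>A change of basis in the binary space is absorbed into the matrix: the columns of
  \<open>M'\<close> are the images of the axis vectors under \<open>A\<close>. Invertibility is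
  tested on the two binary parts of a vector, on each of which \<open>A\<close> is
  injective.\<close>

lemma baer_vec_comp:
  fixes M :: "'a ^ 4 ^ 4"
  assumes "invertible M" and A: "\<And>x y. A (x + y) = A x + A y" "bij A"
  obtains M' where "invertible M'" "\<And>x. baer_vec M' x = baer_vec M (A x)"
proof -
  define M' :: "'a ^ 4 ^ 4" where "M' = (\<chi> i j. baer_vec M (A (axis j 1)) $ i)"
  have col: "baer_vec M' (axis j 1) = baer_vec M (A (axis j 1))" for j
    by (simp add: baer_vec_axis M'_def column_def vec_lambda_eta)
  have eq: "baer_vec M' x = baer_vec M (A x)" for x
    by (rule bit_vec_additive_eqI) (simp_all only: baer_vec_add A col)
  have "invertible M'"
  proof (rule invertibleI)
    fix y assume 0: "M' *v y = 0"
    obtain a b where y: "y = bit_vec a + w *s bit_vec b" by (rule bit_vec_decompose)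
    have "M' *v y = baer_vec M' a + w *s baer_vec M' b"
      by (simp add: y matrix_vector_right_distrib vector_scalar_commute baer_vec_eq)
    also have "\<dots> = M *v (bit_vec (A a) + w *s bit_vec (A b))"
      unfolding eq by (simp add: matrix_vector_right_distrib vector_scalar_commute baer_vec_eq)
    finally have "M *v (bit_vec (A a) + w *s bit_vec (A b)) = 0" using 0 by simp
    then have "A a = 0 \<and> A b = 0"
      by (rule bit_vec_decompose_eq_0[OF invertible_mult_eq_0[OF assms(1)]])
    moreover have "A 0 = 0" using A(1)[of 0 0] by simp
    ultimately have "a = 0 \<and> b = 0" using bij_is_inj[OF A(2)] by (metis injD)
    then show "y = 0" by (simp add: y)
  qed
  then show ?thesis using that eq by blast
qed

end

section \<open>The Hermitian form and Gram matrices\<close>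

locale hermitian_space = four_field w for w :: "'a::{field,finite}" +
  fixes h :: "'a ^ 4 \<Rightarrow> 'a ^ 4 \<Rightarrow> 'a"
  assumes herm: "hermitian_form h" and nondeg: "nondegenerate h"
begin

lemma h_add_left: "h (u + v) z = h u z + h v z"
  and h_scale_left: "h (c *s u) v = c * h u v"
  and h_sym: "h v u = (h u v)\<^sup>2"
  using herm unfolding hermitian_form_def linear_form_iff by blast+

lemma h_add_right: "h u (v + z) = h u v + h u z"
  by (simp only: h_sym[of u "v + z"] h_sym[of u v] h_sym[of u z] h_add_left sq_add)

lemma h_scale_right: "h u (c *s v) = c\<^sup>2 * h u v"
  by (simp only: h_sym[of u "c *s v"] h_sym[of u v] h_scale_left power_mult_distrib)

lemma h_0 [simp]: "h 0 v = 0" "h v 0 = 0"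
  using h_scale_left[of 0 0 v] h_scale_right[of v 0 0] by simp_all

lemma h_eq_0_commute: "h u v = 0 \<longleftrightarrow> h v u = 0"
  using h_sym[of u v] h_sym[of v u] by auto

lemma h_nondeg_left: "(\<And>v. h u v = 0) \<Longrightarrow> u = 0"
  using nondeg unfolding nondegenerate_def by blast

lemma h_nondeg_right: "(\<And>v. h v u = 0) \<Longrightarrow> u = 0"
  using h_nondeg_left h_eq_0_commute by blast

text \<open>The columns of such a matrix are four of the five vectors of an ovoid; the fifth is
  their sum. Requiring the identity for all binary vectors, not just for columns, is convenient in
  use, and \<open>gramI\<close> reduces it to the columns.\<close>

definition gram :: "'a ^ 4 ^ 4 \<Rightarrow> bool" where
  "gram M \<longleftrightarrow> (\<forall>x y. h (baer_vec M x) (baer_vec M y) = of_bit (jform x y))"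

definition conj_vec :: "'a ^ 4 \<Rightarrow> 'a ^ 4" where
  "conj_vec x = (\<chi> i. (x$i)\<^sup>2)"

lemma conj_vec_conj_vec [simp]: "conj_vec (conj_vec x) = x"
  by (simp add: conj_vec_def vec_eq_iff)

lemma conj_vec_add: "conj_vec (x + y) = conj_vec x + conj_vec y"
  by (simp add: conj_vec_def vec_eq_iff sq_add)

lemma conj_vec_scale: "conj_vec (c *s x) = c\<^sup>2 *s conj_vec x"
  by (simp add: conj_vec_def vec_eq_iff power_mult_distrib)

lemma conj_vec_bit_vec: "conj_vec (bit_vec x) = bit_vec x"
  by (simp add: conj_vec_def vec_eq_iff bit_vec_def)

text \<open>Both sides are sesquilinear, and they agree on the binary vectors, which span the space
  and are fixed by conjugation.\<close>

lemma gram_mult: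
  assumes "gram M"
  shows "h (M *v x) (M *v y) = jform x (conj_vec y)"
proof -
  obtain a b where x: "x = bit_vec a + w *s bit_vec b" by (rule bit_vec_decompose)
  obtain c d where y: "y = bit_vec c + w *s bit_vec d" by (rule bit_vec_decompose)
  have g: "h (M *v bit_vec p) (M *v bit_vec q) = jform (bit_vec p) (bit_vec q)" for p q
    using assms by (simp only: gram_def jform_bit_vec flip: baer_vec_eq)
  show ?thesis
    unfolding x y
    by (simp add: matrix_vector_right_distrib vector_scalar_commute h_add_left h_add_right
        h_scale_left h_scale_right g conj_vec_add conj_vec_scale conj_vec_bit_vec
        jform_add_left jform_add_right jform_scale_left jform_scale_right algebra_simps)
qed

lemma gram_invertible:
  assumes "gram M"
  shows "invertible M"
proof (rule invertibleI)
  fix x assume "M *v x = 0"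
  then have "jform x (conj_vec (conj_vec y)) = 0" for y
    using gram_mult[OF assms, of x "conj_vec y"] by simp
  then show "x = 0" using jform_nondegenerate[OF two] by simp
qed

lemma jform_axis_axis: "(of_bit (jform (axis i 1) (axis j 1)) :: 'a) = (if i = j then 0 else 1)"
  for i j :: 4
proof -
  have ax: "axis i 1 \<in> frame" for i :: 4 using exhaust_4[of i] by (auto simp: frame_eq)
  show ?thesis
    using jform_self[of "axis i 1 :: bit ^ 4"] jform_frame[OF ax ax, of i j]
    by (cases "i = j") (simp_all add: axis_eq_axis)
qed

text \<open>The scalar is left general because \<open>gram_of_frame\<close> finds out that it is 1
  only after using this.\<close>

lemma h_baer_vec_eq:
  assumes "\<And>i j. h (baer_vec M (axis i 1)) (baer_vec M (axis j 1)) = (if i = j then 0 else \<gamma>)"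
  shows "h (baer_vec M x) (baer_vec M y) = \<gamma> * of_bit (jform x y)"
proof (rule bit_vec_additive_eqI[where f = "\<lambda>x. h (baer_vec M x) (baer_vec M y)"])
  have *: "h (baer_vec M (axis i 1)) (baer_vec M y) = \<gamma> * of_bit (jform (axis i 1) y)" for i :: 4
    by (rule bit_vec_additive_eqI)
      (simp_all only: baer_vec_add h_add_right jform_add_right of_bit_add distrib_left assms
        jform_axis_axis if_distrib[of "\<lambda>c. \<gamma> * c"] mult_zero_right mult_1_right)
  show "h (baer_vec M (axis 1 1)) (baer_vec M y) = \<gamma> * of_bit (jform (axis 1 1) y)"
    "h (baer_vec M (axis 2 1)) (baer_vec M y) = \<gamma> * of_bit (jform (axis 2 1) y)"
    "h (baer_vec M (axis 3 1)) (baer_vec M y) = \<gamma> * of_bit (jform (axis 3 1) y)"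
    "h (baer_vec M (axis 4 1)) (baer_vec M y) = \<gamma> * of_bit (jform (axis 4 1) y)" by (fact *)+
qed (simp_all only: baer_vec_add h_add_left jform_add_left of_bit_add distrib_left)

lemma gramI:
  assumes "\<And>i j. h (column i M) (column j M) = (if i = j then 0 else 1)"
  shows "gram M"
  unfolding gram_def using h_baer_vec_eq[of M 1] assms by (simp add: baer_vec_axis)

text \<open>By the tangent condition the products of one frame vector with any two others coincide,
  and by symmetry all off-diagonal products equal one \<open>\<gamma>\<close>. It lies in the prime
  field, and \<open>\<gamma> = 0\<close> would make a column orthogonal to the whole space.\<close>

lemma gram_of_frame:
  assumes inv: "invertible M"
    and F2: "\<And>x y. h (baer_vec M x) (baer_vec M y) \<in> {0, 1}"
    and self: "\<And>x. h (baer_vec M x) (baer_vec M x) = 0"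
    and tangent: "\<And>x y z. \<lbrakk>x \<in> frame; y \<in> frame; z \<in> frame; x \<noteq> y; x \<noteq> z; y \<noteq> z\<rbrakk> \<Longrightarrow>
        h (baer_vec M x) (baer_vec M (y + z)) = 0"
  shows "gram M"
proof -
  define g where "g x y = h (baer_vec M x) (baer_vec M y)" for x y
  have g_add: "g (x + y) z = g x z + g y z" "g x (y + z) = g x y + g x z" for x y z
    by (simp_all add: g_def baer_vec_add h_add_left h_add_right)
  have g_sym: "g x y = g y x" for x y
    using F2[of x y] h_sym[of "baer_vec M y" "baer_vec M x"] by (auto simp: g_def)
  have const: "g x y = g x z" if "x \<in> frame" "y \<in> frame" "z \<in> frame" "x \<noteq> y" "x \<noteq> z" for x y z
  proof (cases "y = z")
    case False
    then have "g x y + g x z = 0" using tangent[OF that] g_add(2) by (simp add: g_def)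
    then show ?thesis by (metis add_self add_left_cancel)
  qed simp
  define \<gamma> where "\<gamma> = g (axis 1 1) (axis 2 1)"
  have ax: "axis i 1 \<in> frame" for i :: 4 using exhaust_4[of i] by (auto simp: frame_eq)
  have ax_neq: "(axis i 1 :: bit ^ 4) = axis j 1 \<longleftrightarrow> i = j" for i j :: 4
    by (simp add: axis_eq_axis)
  have g_axis: "g (axis i 1) (axis j 1) = (if i = j then 0 else \<gamma>)" for i j :: 4
  proof -
    have 1: "g (axis 1 1) (axis k 1) = \<gamma>" if "k \<noteq> 1" for k :: 4
      unfolding \<gamma>_def by (rule const) (use that in \<open>simp_all add: ax ax_neq\<close>)
    have "g (axis i 1) (axis j 1) = \<gamma>" if "i \<noteq> j"
    proof (cases "i = 1")
      case False
      then have "g (axis i 1) (axis j 1) = g (axis i 1) (axis 1 1)"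
        by (intro const) (use that in \<open>simp_all add: ax ax_neq\<close>)
      then show ?thesis using 1[OF False] g_sym by simp
    qed (use 1 that in simp)
    then show ?thesis using self by (simp add: g_def)
  qed
  have g_eq: "g x y = \<gamma> * of_bit (jform x y)" for x y
    unfolding g_def by (rule h_baer_vec_eq) (rule g_axis[unfolded g_def])
  have "\<gamma> \<noteq> 0"
  proof
    assume "\<gamma> = 0"
    then have z: "h (baer_vec M x) (baer_vec M y) = 0" for x y using g_eq by (simp add: g_def)
    have "h (baer_vec M (axis 1 1)) v = 0" for v
    proof -
      obtain u where v: "v = M *v u" using inv by (rule invertible_surj)
      obtain a b where u: "u = bit_vec a + w *s bit_vec b" by (rule bit_vec_decompose)
      show ?thesis
        unfolding v u using z
        by (simp add: matrix_vector_right_distrib vector_scalar_commute h_add_right h_scale_right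
            flip: baer_vec_eq)
    qed
    then have "baer_vec M (axis 1 1) = 0" by (rule h_nondeg_left)
    then show False using baer_vec_nonzero[OF inv] by (simp add: axis_eq_0_iff)
  qed
  then have "\<gamma> = 1" using F2 by (auto simp: \<gamma>_def g_def)
  then show ?thesis using g_eq by (simp add: gram_def g_def)
qed

end

section \<open>From an elliptic ovoid to a Gram matrix\<close>

context hermitian_space
begin

lemma alternating_commute:
  assumes f: "bilinear_form f" "\<And>v. f v v = 0"
  shows "f u v = f v (u :: 'a ^ 4)"
proof -
  have "f u v + f v u = f (u + v) (u + v)"
    by (simp only: bilinear_formD[OF f(1)] f(2)[of u] f(2)[of v] add_0 add_0_right add.commute)
  then have "f u v + f v u = 0" by (simp only: f(2))
  then show ?thesis by (metis add_self add_left_cancel)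
qed

lemma nondegenerate_value_1:
  assumes "u \<noteq> 0"
  obtains v where "h v u = 1"
proof -
  obtain v where v: "h v u \<noteq> 0" using h_nondeg_right assms by blast
  have "h (inverse (h v u) *s v) u = 1" using v by (simp add: h_scale_left)
  then show ?thesis by (rule that)
qed

text \<open>On a Baer subgeometry of common absolute points the forms of \<open>perp\<close> and \<open>T\<close> agree up to
  one scalar: point by point by comparing hyperplanes, and the scalars of two points coincide
  because of the third point on the line joining them.\<close>

lemma forms_proportional:
  assumes inv: "invertible M" and f: "bilinear_form f" "nondegenerate f" "\<And>v. f v v = 0"
    and fix_pt: "\<And>x. x \<noteq> 0 \<Longrightarrow> form_perp f (form_perp h (pt (baer_vec M x))) = pt (baer_vec M x)"
  obtains c where "c \<noteq> 0" "\<And>x v. f v (baer_vec M x) = c * h v (baer_vec M x)"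
proof -
  note f_simps = bilinear_formD[OF f(1)]
  have f_sym: "f u v = f v u" for u v
    by (rule alternating_commute[OF f(1)]) (rule f(3))
  \<comment> \<open>A vector orthogonal to the point under \<open>h\<close> lies in its unitary
    polar, whose symplectic polar is again the point; so it is orthogonal to the point under
    \<open>f\<close> too.\<close>
  have ker: "f v (baer_vec M x) = 0" if "x \<noteq> 0" "h v (baer_vec M x) = 0" for v x
  proof -
    have "v \<in> form_perp h (pt (baer_vec M x))"
    proof -
      have "h (baer_vec M x) v = 0" using that(2) h_eq_0_commute by blast
      then show ?thesis by (auto simp: form_perp_def in_pt_iff h_scale_left)
    qed
    moreover have "baer_vec M x \<in> form_perp f (form_perp h (pt (baer_vec M x)))"
      using fix_pt[OF that(1)] vec.span_base by blast
    ultimately show ?thesis by (simp add: form_perp_def)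
  qed
  have "\<exists>c. \<forall>v. f v (baer_vec M x) = c * h v (baer_vec M x)" if "x \<noteq> 0" for x
  proof -
    \<comment> \<open>Subtracting the multiple \<open>h v (baer_vec M x)\<close> of
      \<open>v0\<close> moves any \<open>v\<close> into the common hyperplane, so the value at
      \<open>v0\<close> is the scalar of the point.\<close>
    obtain v0 where v0: "h v0 (baer_vec M x) = 1"
      using nondegenerate_value_1 baer_vec_nonzero[OF inv \<open>x \<noteq> 0\<close>] by blast
    have "f v (baer_vec M x) = f v0 (baer_vec M x) * h v (baer_vec M x)" for v
    proof -
      have "f (v + h v (baer_vec M x) *s v0) (baer_vec M x) = 0"
        by (rule ker[OF that]) (simp add: h_add_left h_scale_left v0)
      then have "f v (baer_vec M x) + h v (baer_vec M x) * f v0 (baer_vec M x) = 0"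
        by (simp add: f_simps)
      then show ?thesis by (metis add_self add_left_cancel mult.commute)
    qed
    then show ?thesis by blast
  qed
  then obtain c where c: "\<And>x v. x \<noteq> 0 \<Longrightarrow> f v (baer_vec M x) = c x * h v (baer_vec M x)"
    by metis
  have c_eq: "c x = c y" if "x \<noteq> 0" "y \<noteq> 0" "x \<noteq> y" for x y
  proof -
    let ?z = "x + y"
    have "?z \<noteq> 0" using that by (simp add: bit_vec_add_eq_0_iff)
    \<comment> \<open>The coefficients are squared since \<open>h\<close> squares scalars in its
      second argument, and squaring twice is the identity.\<close>
    have "h v ((c ?z + c x)\<^sup>2 *s baer_vec M x + (c ?z + c y)\<^sup>2 *s baer_vec M y) = 0" for v
    proof -
      have "c ?z * (h v (baer_vec M x) + h v (baer_vec M y)) =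
          c x * h v (baer_vec M x) + c y * h v (baer_vec M y)"
        using c[OF \<open>?z \<noteq> 0\<close>, of v] c[OF that(1), of v] c[OF that(2), of v]
        by (simp add: baer_vec_add h_add_right f_simps)
      then have "(c ?z * h v (baer_vec M x) + c ?z * h v (baer_vec M y)) +
          (c x * h v (baer_vec M x) + c y * h v (baer_vec M y)) = 0"
        by (simp only: distrib_left add_self)
      then show ?thesis by (simp only: h_add_right h_scale_right sq_sq ring_distribs ac_simps)
    qed
    then have "(c ?z + c x)\<^sup>2 *s baer_vec M x + (c ?z + c y)\<^sup>2 *s baer_vec M y = 0"
      by (rule h_nondeg_right)
    then have "(c ?z + c x)\<^sup>2 = 0 \<and> (c ?z + c y)\<^sup>2 = 0"
      by (rule baer_vec_independent[OF inv that])
    then have "c ?z + c x = 0" "c ?z + c y = 0" by simp_all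
    then show ?thesis by (metis add_self add_left_cancel)
  qed
  have ax: "(axis 1 1 :: bit ^ 4) \<noteq> 0" by (simp add: axis_eq_0_iff)
  have all: "f v (baer_vec M x) = c (axis 1 1) * h v (baer_vec M x)" for x v
  proof (cases "x = 0")
    case True
    then show ?thesis using f_simps(4)[of v 0 0] by simp
  next
    case False
    then have "c x = c (axis 1 1)" using c_eq[OF False ax] by (cases "x = axis 1 1") auto
    then show ?thesis using c[OF False] by simp
  qed
  moreover have "c (axis 1 1) \<noteq> 0"
  proof
    assume "c (axis 1 1) = 0"
    then have "f (baer_vec M (axis 1 1)) v = 0" for v using all f_sym by simp
    then have "baer_vec M (axis 1 1) = 0" using f(2) by (simp add: nondegenerate_def)
    then show False using baer_vec_nonzero[OF inv ax] by simp
  qed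
  ultimately show ?thesis using that by blast
qed

text \<open>The matrices provided by the two assumptions may differ; they share only the points and
  lines of \<open>W\<close>. On these points \<open>f\<close> is a multiple of \<open>h\<close>, so
  symmetry of \<open>f\<close> puts the values of \<open>h\<close> into the prime field, and
  isotropy of the generators for \<open>f\<close> gives the tangent condition of
  \<open>gram_of_frame\<close>.\<close>

lemma symplectic_subquadrangle_frame:
  assumes W: "symplectic_subquadrangle (form_perp h) W" and X: "elliptic_ovoid W X"
  obtains M where "gram M" "X = frame_points M"
    "W = (baer_points M, {l \<in> baer_lines M. card (l \<inter> X) = 1})"
proof -
  obtain M0 E where M0: "invertible M0" "fst W = baer_points M0" "elliptic_quadric E"
      "X = baer_ext M0 ` E" "{l \<in> baer_lines M0. card (l \<inter> X) = 1} = snd W"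
    using X by (auto simp: elliptic_ovoid_def)
  obtain A where A: "\<And>x y. A (x + y) = A x + A y" "bij A" "E = pt ` A ` frame"
    by (rule elliptic_quadric_frame[OF M0(3)]) (rule that)
  \<comment> \<open>The new matrix describes the same subgeometry, with the quadric in standard
    position.\<close>
  obtain M where inv: "invertible M" and M: "\<And>x. baer_vec M x = baer_vec M0 (A x)"
    by (rule baer_vec_comp[OF M0(1) A(1,2)]) (rule that)
  have "baer_vec M = baer_vec M0 \<circ> A" using M by auto
  then have range: "range (baer_vec M) = range (baer_vec M0)"
    using bij_is_surj[OF A(2)] by (simp only: image_comp[symmetric])
  have pts: "fst W = baer_points M"
    using M0(1,2) range inv by (simp add: baer_points_eq)
  have lines: "snd W = {l \<in> baer_lines M. card (l \<inter> X) = 1}"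
    using M0(1,5) range inv by (simp add: baer_lines_eq)
  have Xf: "X = frame_points M"
    by (simp add: M0(4) A(3) frame_points_def image_image baer_ext_pt M)
  obtain M' t T s where conj: "invertible M' \<and> symplectic_polarity t \<and>
      W = symplectic_quadrangle M' t \<and> symplectic_polarity T \<and> extends_polarity M' t T \<and>
      semilinear_involution s \<and> {P \<in> pg_points. s ` P = P} = baer_points M' \<and>
      (\<forall>U. vec.subspace U \<longrightarrow> T (form_perp h U) = s ` U \<and> form_perp h (T U) = s ` U)"
    using W unfolding symplectic_subquadrangle_def by (elim exE) (rule that)
  note W' = conj[THEN conjunct2, THEN conjunct1] conj[THEN conjunct2, THEN conjunct2, THEN conjunct1]
  note W'' = conj[THEN conjunct2, THEN conjunct2, THEN conjunct2]
  note W' = W' W''[THEN conjunct1] W''[THEN conjunct2, THEN conjunct1]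
    W''[THEN conjunct2, THEN conjunct2, THEN conjunct2, THEN conjunct1]
    W''[THEN conjunct2, THEN conjunct2, THEN conjunct2, THEN conjunct2]
  obtain f where f: "bilinear_form f" "\<And>v. f v v = 0" "nondegenerate f" "T = form_perp f"
    using W'(3) unfolding symplectic_polarity_def by blast
  have pts': "baer_points M = {P \<in> pg_points. s ` P = P}"
    using pts W'(2,5) by (simp add: symplectic_quadrangle_def)
  have fix_pt: "form_perp f (form_perp h (pt (baer_vec M x))) = pt (baer_vec M x)" if "x \<noteq> 0" for x
  proof -
    have "pt (baer_vec M x) \<in> baer_points M"
      using baer_vec_nonzero[OF inv that] by (auto simp: baer_points_eq[OF inv] span_points_def)
    then have "s ` pt (baer_vec M x) = pt (baer_vec M x)" using pts' by blast
    then show ?thesis using spec[OF W'(6), of "pt (baer_vec M x)"] f(4) by simp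
  qed
  obtain c where c: "c \<noteq> 0" "\<And>x v. f v (baer_vec M x) = c * h v (baer_vec M x)"
    by (rule forms_proportional[OF inv f(1,3,2)]) (erule fix_pt, rule that)
  have f_sym: "f u v = f v u" for u v
    by (rule alternating_commute[OF f(1)]) (rule f(2))
  \<comment> \<open>A generator is totally isotropic for the polarity \<open>t\<close> of the binary
    space, and \<open>extends_polarity\<close> transports this to \<open>T\<close>.\<close>
  have isotropic: "f v u = 0" if "l \<in> snd W" "P \<in> l" "P' \<in> l" "u \<in> P" "v \<in> P'" for l P P' u v
  proof -
    have "snd W = baer_line M' ` {L \<in> pg_lines. L \<subseteq> t L}"
      by (simp add: W'(2) symplectic_quadrangle_def)
    then have "l \<in> baer_line M' ` {L \<in> pg_lines. L \<subseteq> t L}" using that(1) by simp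
    then obtain L where L': "L \<in> {L \<in> pg_lines. L \<subseteq> t L}" "l = baer_line M' L" by (rule imageE)
    then have L: "L \<in> pg_lines" "L \<subseteq> t L" by simp_all
    have "P \<in> baer_ext M' ` points_on L" "P' \<in> baer_ext M' ` points_on L"
      using that(2,3) by (simp_all add: L'(2) baer_line_def)
    then obtain p p' where p: "p \<in> points_on L" "P = baer_ext M' p"
      and p': "p' \<in> points_on L" "P' = baer_ext M' p'"
      by (elim imageE) (rule that)
    have sub: "p \<subseteq> L" "p' \<subseteq> L" "vec.subspace p'"
      using p(1) p'(1) by (simp_all add: points_on_def pg_points_def)
    obtain g where g: "t = form_perp g" using W'(1) unfolding symplectic_polarity_def by blast
    have "t L \<subseteq> t p'" unfolding g form_perp_def using sub(2) by blast
    then have "P \<subseteq> baer_ext M' (t p')"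
      unfolding p(2) baer_ext_def using sub(1) L(2) by (intro vec.span_mono image_mono) blast
    also have "\<dots> = form_perp f P'"
      using W'(4) sub(3) f(4) p'(2) by (simp add: extends_polarity_def)
    finally show ?thesis using that(4,5) by (auto simp: form_perp_def)
  qed
  have "gram M"
  proof (rule gram_of_frame[OF inv])
    fix x y
    \<comment> \<open>Symmetry of \<open>f\<close> makes \<open>h\<close> symmetric here; as
      swapping the arguments of \<open>h\<close> squares the value, the value equals its own
      square.\<close>
    have "c * h (baer_vec M x) (baer_vec M y) = c * h (baer_vec M y) (baer_vec M x)"
      using c(2)[of "baer_vec M x" y] c(2)[of "baer_vec M y" x] f_sym by simp
    then have "h (baer_vec M x) (baer_vec M y) = h (baer_vec M y) (baer_vec M x)" using c(1) by simp
    then have "(h (baer_vec M x) (baer_vec M y))\<^sup>2 = h (baer_vec M x) (baer_vec M y)"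
      using h_sym by metis
    then show "h (baer_vec M x) (baer_vec M y) \<in> {0, 1}" by (simp add: sq_eq_self_iff)
  next
    fix x
    show "h (baer_vec M x) (baer_vec M x) = 0" using c f(2) by (metis mult_eq_0_iff)
  next
    fix x y z
    assume xyz: "x \<in> frame" "y \<in> frame" "z \<in> frame" "x \<noteq> y" "x \<noteq> z" "y \<noteq> z"
    have nz: "x \<noteq> 0" "y + z \<noteq> 0" "x \<noteq> y + z" "x + (y + z) \<noteq> 0"
      using xyz frame_sum3[OF xyz] by (auto simp: frame_def bit_vec_add_eq_0_iff)
    let ?l = "line3 (baer_vec M x) (baer_vec M (y + z))"
    have l: "?l = pt ` baer_vec M ` {x, y + z, x + (y + z)}"
      by (simp add: line3_def baer_vec_add)
    \<comment> \<open>So \<open>?l\<close> is a tangent of the ovoid, hence a generator of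
      \<open>W\<close>.\<close>
    have "?l \<inter> X = {pt (baer_vec M x)}"
    proof (intro equalityI subsetI)
      fix P assume "P \<in> ?l \<inter> X"
      then obtain a b where ab: "P = pt (baer_vec M a)" "a \<in> {x, y + z, x + (y + z)}"
          "P = pt (baer_vec M b)" "b \<in> frame"
        unfolding l Xf frame_points_def by blast
      moreover have "a \<noteq> 0" "b \<noteq> 0" using ab nz by (auto simp: frame_def)
      ultimately have "a = b" using pt_baer_vec_eq_iff[OF inv] by blast
      then have "a = x" using ab frame_sum3[OF xyz] by (auto simp: add.assoc)
      then show "P \<in> {pt (baer_vec M x)}" using ab by simp
    next
      fix P assume "P \<in> {pt (baer_vec M x)}"
      then show "P \<in> ?l \<inter> X" using xyz(1) by (simp add: l Xf frame_points_def)
    qed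
    moreover have "?l \<in> baer_lines M"
      unfolding baer_lines_eq[OF inv]
      by (rule span_linesI) (use nz baer_vec_nonzero[OF inv] baer_vec_eq_iff[OF inv] in simp_all)
    ultimately have "?l \<in> snd W" by (simp add: lines)
    then have "f (baer_vec M x) (baer_vec M (y + z)) = 0"
      by (rule isotropic[of _ "pt (baer_vec M (y + z))" "pt (baer_vec M x)"])
        (simp_all add: l vec.span_base)
    then show "h (baer_vec M x) (baer_vec M (y + z)) = 0" using c by (metis mult_eq_0_iff)
  qed
  then show ?thesis
    by (rule that[OF _ Xf]) (use pts lines in \<open>simp add: prod_eq_iff\<close>)
qed

end

section \<open>Uniqueness of the subquadrangle of an ovoid\<close>

context hermitian_space
begin

text \<open>Equal point sets make the frame vectors agree up to order and individual scalars
  \<open>c x\<close>. Since distinct frame vectors have product 1 for both matrices,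
  \<open>c x\<close> times the square of \<open>c y\<close> is 1, and as non-zero scalars have cube
  1 all these scalars coincide.\<close>

lemma frame_points_proportional:
  assumes g: "gram M" "gram M'" and eq: "frame_points M = frame_points M'"
  obtains c where "c \<noteq> 0" "\<And>x. \<exists>y. baer_vec M' x = c *s baer_vec M y"
proof -
  have nz: "baer_vec M x \<noteq> 0" if "x \<in> frame" for x
    using that baer_vec_nonzero[OF gram_invertible[OF g(1)]] by (simp add: frame_def)
  have "\<exists>y c. c \<noteq> 0 \<and> y \<in> frame \<and> baer_vec M' x = c *s baer_vec M y" if "x \<in> frame" for x
  proof -
    have "pt (baer_vec M' x) \<in> frame_points M" using that eq by (auto simp: frame_points_def)
    then obtain y where "y \<in> frame" "pt (baer_vec M' x) = pt (baer_vec M y)"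
      by (auto simp: frame_points_def)
    then show ?thesis using pt_eq_iff[OF nz] by blast
  qed
  then obtain p c where pc: "\<And>x. x \<in> frame \<Longrightarrow> c x \<noteq> 0 \<and> baer_vec M' x = c x *s baer_vec M (p x)"
    by metis
  have c_eq: "c x = c y" if "x \<in> frame" "y \<in> frame" "x \<noteq> y" for x y
  proof -
    have "h (baer_vec M' x) (baer_vec M' y) = 1"
      using g(2) jform_frame[OF that] by (simp add: gram_def)
    then have "(c y)\<^sup>2 * (c x * of_bit (jform (p x) (p y))) = 1"
      using g(1) pc[OF that(1)] pc[OF that(2)] by (simp add: gram_def h_scale_left h_scale_right)
    then have "c x * (c y)\<^sup>2 = 1" by (cases "jform (p x) (p y)") (simp_all add: mult.commute)
    then have "c x * (c y * (c y)\<^sup>2) = c y" by (simp add: ac_simps)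
    then show ?thesis using cube pc[OF that(2)] by simp
  qed
  have ax: "axis i 1 \<in> frame" for i :: 4 using exhaust_4[of i] by (auto simp: frame_eq)
  define k where "k = c (axis 1 1)"
  have k: "c (axis i 1) = k" for i :: 4
    using c_eq[OF ax ax, of i 1] unfolding k_def by (cases "i = 1") (auto simp: axis_eq_axis)
  \<comment> \<open>The additive extension of \<open>p\<close> from the axis vectors;
    \<open>p\<close> itself is known only on the frame.\<close>
  define q where "q x = x$1 *s p (axis 1 1) + x$2 *s p (axis 2 1) + x$3 *s p (axis 3 1) +
    x$4 *s p (axis 4 1)" for x :: "bit ^ 4"
  have q_add: "q (x + y) = q x + q y" for x y
    by (simp only: q_def vector_add_component vec.scale_left_distrib ac_simps)
  have q_axis: "q (axis 1 1) = p (axis 1 1)" "q (axis 2 1) = p (axis 2 1)"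
      "q (axis 3 1) = p (axis 3 1)" "q (axis 4 1) = p (axis 4 1)"
    by (simp_all add: q_def axis_def)
  have M'_axis: "baer_vec M' (axis i 1) = k *s baer_vec M (p (axis i 1))" for i :: 4
    using pc[OF ax] k by metis
  have "baer_vec M' x = k *s baer_vec M (q x)" for x
    by (rule bit_vec_additive_eqI)
      (simp_all only: baer_vec_add q_add vec.scale_right_distrib M'_axis q_axis)
  moreover have "k \<noteq> 0" using pc[OF ax] unfolding k_def by blast
  ultimately show ?thesis using that by blast
qed

text \<open>A common scalar changes neither points nor lines, so one inclusion follows, and the
  other by exchanging the matrices. This justifies the definite description in
  \<open>subquadrangle_of\<close>.\<close>

lemma frame_points_determine:
  assumes g: "gram M" "gram M'" and eq: "frame_points M = frame_points M'"
  shows "baer_points M' = baer_points M \<and> baer_lines M' = baer_lines M"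
proof -
  have sub: "span_points (range (baer_vec M')) \<subseteq> span_points (range (baer_vec M)) \<and>
      span_lines (range (baer_vec M')) \<subseteq> span_lines (range (baer_vec M))"
    if g: "gram M" "gram M'" and eq: "frame_points M = frame_points M'" for M M'
  proof -
    obtain c where c: "c \<noteq> 0" "\<And>x. \<exists>y. baer_vec M' x = c *s baer_vec M y"
      by (rule frame_points_proportional[OF g eq]) (rule that)
    have pt_c: "pt (c *s v) = pt v" for v
      using c(1) pt_eq_iff by (cases "v = 0") auto
    have *: "\<exists>v. v \<in> range (baer_vec M) \<and> v \<noteq> 0 \<and> u = c *s v"
      if "u \<in> range (baer_vec M')" "u \<noteq> 0" for u
    proof -
      obtain x where "u = baer_vec M' x" using \<open>u \<in> range (baer_vec M')\<close> by blast
      then obtain y where "u = c *s baer_vec M y" using c(2) by blast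
      moreover from this have "baer_vec M y \<noteq> 0" using that(2) by auto
      ultimately show ?thesis by blast
    qed
    have "P \<in> span_points (range (baer_vec M))" if P: "P \<in> span_points (range (baer_vec M'))" for P
    proof -
      obtain u where u: "u \<in> range (baer_vec M')" "u \<noteq> 0" "P = pt u"
        using P unfolding span_points_def by blast
      obtain v where "v \<in> range (baer_vec M)" "v \<noteq> 0" "u = c *s v" using *[OF u(1,2)] by blast
      then show ?thesis unfolding u(3) by (auto simp: pt_c span_points_def)
    qed
    moreover have "l \<in> span_lines (range (baer_vec M))"
      if l: "l \<in> span_lines (range (baer_vec M'))" for l
    proof -
      obtain u u' where u: "u \<in> range (baer_vec M')" "u' \<in> range (baer_vec M')" "u \<noteq> 0"
          "u' \<noteq> 0" "u \<noteq> u'" "l = line3 u u'"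
        using l by (rule span_linesE)
      obtain v where v: "v \<in> range (baer_vec M)" "v \<noteq> 0" "u = c *s v"
        using *[OF u(1,3)] by blast
      obtain v' where v': "v' \<in> range (baer_vec M)" "v' \<noteq> 0" "u' = c *s v'"
        using *[OF u(2,4)] by blast
      have "l = line3 v v'"
        unfolding u(6) v(3) v'(3) line3_def vec.scale_right_distrib[symmetric]
        by (simp only: image_insert image_empty pt_c)
      moreover have "v \<noteq> v'" using u(5) v(3) v'(3) by blast
      ultimately show ?thesis using span_linesI[OF v(1) v'(1) v(2) v'(2)] by simp
    qed
    ultimately show ?thesis by blast
  qed
  show ?thesis
    unfolding baer_points_eq[OF gram_invertible[OF g(1)]] baer_points_eq[OF gram_invertible[OF g(2)]]
      baer_lines_eq[OF gram_invertible[OF g(1)]] baer_lines_eq[OF gram_invertible[OF g(2)]]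
    using sub[OF g eq] sub[OF g(2,1) eq[symmetric]] by blast
qed

section \<open>Orthonormal bases and the existence of a Gram matrix\<close>

lemma h_sum_left: "h (\<Sum>i\<in>S. f i) v = (\<Sum>i\<in>S. h (f i) v)"
  by (induction S rule: infinite_finite_induct) (simp_all add: h_add_left)

text \<open>Values \<open>h v v\<close> lie in the prime field, so without such a vector the
  orthogonal complement \<open>P\<close> of \<open>S\<close> would consist of isotropic vectors. It
  would then be totally isotropic, hence orthogonal to everything and zero, and \<open>S\<close>
  would span the space with at most three vectors.\<close>

lemma ex_unit_orthogonal:
  assumes S: "finite S" "card S \<le> 3"
    and orth: "\<And>u v. \<lbrakk>u \<in> S; v \<in> S\<rbrakk> \<Longrightarrow> h u v = (if u = v then 1 else 0)"
  obtains v where "h v v = 1" "\<And>u. u \<in> S \<Longrightarrow> h u v = 0"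
proof (rule ccontr)
  assume neg: "\<not> thesis"
  define P where "P = {v. \<forall>u\<in>S. h u v = 0}"
  have iso: "h v v = 0" if "v \<in> P" for v
  proof -
    have "h v v = (h v v)\<^sup>2" by (rule h_sym)
    then have "h v v = 0 \<or> h v v = 1" by (metis sq_eq_self_iff)
    then show ?thesis using that neg \<open>\<And>v. h v v = 1 \<Longrightarrow> (\<And>u. u \<in> S \<Longrightarrow> h u v = 0) \<Longrightarrow> thesis\<close>
      by (auto simp: P_def)
  qed
  have P_add: "u + v \<in> P" "c *s u \<in> P" if "u \<in> P" "v \<in> P" for u v c
    using that by (auto simp: P_def h_add_right h_scale_right)
  have P_orth: "h u v = 0" if "u \<in> P" "v \<in> P" for u v
  proof -
    have sum: "h u v + h v u = 0" if "u \<in> P" "v \<in> P" for u v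
      using iso[OF P_add(1)[OF that]] iso[OF that(1)] iso[OF that(2)]
      by (simp add: h_add_left h_add_right add.commute)
    have "h u v = h v u" using sum[OF that] by (metis add_self add_left_cancel)
    \<comment> \<open>Polarizing a second time with \<open>w *s u\<close> separates the two
      products, because \<open>w + w * w = 1\<close>.\<close>
    moreover have "w * h u v + w\<^sup>2 * h v u = 0"
      using sum[OF P_add(2)[OF that(1) that(1), of w] that(2)] by (simp add: h_scale_left h_scale_right)
    ultimately have "(w + w * w) * h u v = 0" by (simp add: power2_eq_square algebra_simps)
    moreover have "w + w * w = 1" by (simp add: w_sq add.left_commute)
    ultimately show ?thesis by simp
  qed
  define proj where "proj z = z + (\<Sum>u\<in>S. h z u *s u)" for z
  have proj_h: "h (proj z) v = h z v + (\<Sum>u\<in>S. h z u * h u v)" for z v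
    by (simp add: proj_def h_add_left h_sum_left h_scale_left)
  have proj_P: "proj z \<in> P" for z
  proof -
    have "h (proj z) v = 0" if "v \<in> S" for v
    proof -
      have "(\<Sum>u\<in>S. h z u * h u v) = (\<Sum>u\<in>S. if u = v then h z v else 0)"
        using orth that by (intro sum.cong) auto
      also have "\<dots> = h z v" using S(1) that by simp
      finally show ?thesis by (simp add: proj_h)
    qed
    then show ?thesis unfolding P_def using h_eq_0_commute by blast
  qed
  have P_0: "v = 0" if "v \<in> P" for v
  proof (rule h_nondeg_right)
    fix z
    have "(\<Sum>u\<in>S. h z u * h u v) = 0" using that by (intro sum.neutral) (auto simp: P_def)
    then show "h z v = 0" using P_orth[OF proj_P that, of z] by (simp add: proj_h)
  qed
  have "z \<in> vec.span S" for z
  proof -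
    have "z + (\<Sum>u\<in>S. h z u *s u) = 0" using P_0[OF proj_P[of z]] by (simp add: proj_def)
    then have eq: "z = (\<Sum>u\<in>S. h z u *s u)" by (simp only: vec_add_eq_0_iff)
    show ?thesis by (subst eq) (intro vec.span_sum vec.span_scale vec.span_base)
  qed
  then show False using not_spanned_by_3[OF S] by blast
qed

lemma ex_orthonormal_basis:
  obtains a b c d where "h a a = 1" "h b b = 1" "h c c = 1" "h d d = 1"
    "h a b = 0" "h a c = 0" "h a d = 0" "h b c = 0" "h b d = 0" "h c d = 0"
    "h b a = 0" "h c a = 0" "h d a = 0" "h c b = 0" "h d b = 0" "h d c = 0"
proof -
  obtain a where a: "h a a = 1" by (rule ex_unit_orthogonal[of "{}"]) simp_all
  obtain b where b: "h b b = 1" "h a b = 0"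
    by (rule ex_unit_orthogonal[of "{a}"]) (use a in simp_all)
  have ba: "h b a = 0" using b h_eq_0_commute by blast
  have ab: "a \<noteq> b" using a b by auto
  obtain c where c: "h c c = 1" "h a c = 0" "h b c = 0"
    by (rule ex_unit_orthogonal[of "{a, b}"]) (use a b ba ab in \<open>auto simp: card_insert_if\<close>)
  have ca: "h c a = 0" "h c b = 0" using c h_eq_0_commute by blast+
  have neq: "a \<noteq> c" "b \<noteq> c" using a b c by auto
  obtain d where d: "h d d = 1" "h a d = 0" "h b d = 0" "h c d = 0"
    by (rule ex_unit_orthogonal[of "{a, b, c}"])
      (use a b ba ab c ca neq in \<open>auto simp: card_insert_if\<close>)
  have "h d a = 0" "h d b = 0" "h d c = 0" using d h_eq_0_commute by blast+
  then show ?thesis using that a b ba c ca d by blast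
qed

text \<open>This supplies the coordinate system in which the 216 ovoids are counted.\<close>

lemma ex_gram: "\<exists>M. gram M"
proof -
  obtain a b c d where o: "h a a = 1" "h b b = 1" "h c c = 1" "h d d = 1"
    "h a b = 0" "h a c = 0" "h a d = 0" "h b c = 0" "h b d = 0" "h c d = 0"
    "h b a = 0" "h c a = 0" "h d a = 0" "h c b = 0" "h d b = 0" "h d c = 0"
    by (rule ex_orthonormal_basis)
  \<comment> \<open>Sums of two orthonormal vectors are isotropic and those sharing \<open>a\<close>
    have product 1. Product 1 with the first three columns forces coefficients t, 1+t, 1+t, 1+t on
    the fourth; it is isotropic exactly if t is \<open>w\<close> or \<open>1 + w\<close>.\<close>
  define col :: "4 \<Rightarrow> 'a ^ 4" where "col j = (if j = 1 then a + b else if j = 2 then a + c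
    else if j = 3 then a + d else w *s a + (1 + w) *s b + (1 + w) *s c + (1 + w) *s d)" for j
  define M :: "'a ^ 4 ^ 4" where "M = (\<chi> i j. col j $ i)"
  have M: "column j M = col j" for j by (simp add: M_def column_def vec_eq_iff)
  have sq: "w\<^sup>2 = 1 + w" "(1 + w)\<^sup>2 = w" by (simp_all add: power2_eq_square w_sq field_mult)
  have "h (col i) (col j) = (if i = j then 0 else 1)" for i j
    using exhaust_4[of i] exhaust_4[of j]
    by (elim disjE) (simp_all add: col_def h_add_left h_add_right h_scale_left h_scale_right o sq field_mult)
  then have "gram M" by (intro gramI) (simp add: M)
  then show ?thesis by blast
qed

end

section \<open>From a Gram matrix to a symplectic subquadrangle\<close>

lemma form_perp_subspace:
  assumes "bilinear_form f"
  shows "vec.subspace (form_perp f S)"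
proof -
  note f_simps = bilinear_formD[OF assms]
  have "f u 0 = 0" for u using f_simps(4)[of u 0 0] by simp
  then show ?thesis by (auto simp: vec.subspace_def form_perp_def f_simps)
qed

lemma form_perp_span:
  assumes "bilinear_form f"
  shows "form_perp f (vec.span S) = form_perp f S"
proof (intro equalityI subsetI)
  fix v assume "v \<in> form_perp f (vec.span S)"
  then show "v \<in> form_perp f S" by (auto simp: form_perp_def vec.span_base)
next
  note f_simps = bilinear_formD[OF assms]
  fix v assume v: "v \<in> form_perp f S"
  have "f 0 v = 0" using f_simps(3)[of 0 0 v] by simp
  then have "vec.subspace {u. f u v = 0}" by (auto simp: vec.subspace_def f_simps)
  then have "vec.span S \<subseteq> {u. f u v = 0}"
    using v by (intro vec.span_minimal) (auto simp: form_perp_def)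
  then show "v \<in> form_perp f (vec.span S)" by (auto simp: form_perp_def)
qed

lemma ex_separating_functional:
  fixes U :: "('b::field ^ 'n) set"
  assumes "vec.subspace U" "v \<notin> U"
  obtains g where "Vector_Spaces.linear (*s) (*) g" "\<And>u. u \<in> U \<Longrightarrow> g u = 0" "g v = 1"
proof -
  interpret vp: vector_space_pair "(*s) :: 'b \<Rightarrow> 'b ^ 'n \<Rightarrow> 'b ^ 'n" "(*) :: 'b \<Rightarrow> 'b \<Rightarrow> 'b"
    by (simp add: vector_space_pair_def vec.vector_space_axioms
        vector_space_over_itself.vector_space_axioms)
  obtain B where B: "B \<subseteq> U" "vec.independent B" "U \<subseteq> vec.span B"
    using vec.basis_exists[of U] by metis
  have span: "vec.span B \<subseteq> U" using B(1) assms(1) by (rule vec.span_minimal)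
  then have "v \<notin> vec.span B" using assms(2) by blast
  then have "vec.independent (insert v B)" using B(2) vec.independent_insert[of v B] by auto
  then obtain g where g: "Vector_Spaces.linear (*s) (*) g" "\<forall>x\<in>insert v B. g x = (if x = v then 1 else 0)"
    using vp.linear_independent_extend[of "insert v B" "\<lambda>x. if x = v then 1 else 0"] by blast
  have "v \<notin> B" using span assms(2) vec.span_base by blast
  then have "g x = 0" if "x \<in> B" for x using g(2) that by auto
  then have "g u = 0" if "u \<in> U" for u
    using vp.linear_eq_0_on_span[OF g(1), of B u] B(3) that by blast
  moreover have "g v = 1" using g(2) by simp
  ultimately show ?thesis using that g(1) by blast
qed

lemma bilinear_jform: "bilinear_form jform"
  by (simp add: bilinear_form_def linear_form_iff jform_add_left jform_add_right
      jform_scale_left jform_scale_right)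

lemma bit_two: "(1::bit) + 1 = 0" by simp

lemma frame_neq_0: "x \<in> frame \<Longrightarrow> x \<noteq> 0"
  by (simp add: frame_def)

lemma pt_in_frame_iff: "p \<noteq> 0 \<Longrightarrow> pt p \<in> pt ` frame \<longleftrightarrow> p \<in> frame"
  by (auto simp: bit_pt_eq doubleton_eq_iff)

lemma quadric_frame_form: "quadric frame_form = pt ` frame"
proof (intro equalityI subsetI)
  fix P assume "P \<in> quadric frame_form"
  then have "P \<in> pg_points" "\<forall>v\<in>P. frame_form v = 0" by (simp_all add: quadric_def)
  then obtain x where "x \<noteq> 0" "P = pt x" "frame_form x = 0"
    unfolding pg_points_eq using vec.span_base by blast
  then show "P \<in> pt ` frame" by (simp add: frame_def)
next
  fix P assume "P \<in> pt ` frame"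
  then obtain x where "P = pt x" "x \<noteq> 0" "frame_form x = 0" by (auto simp: frame_def)
  moreover have "frame_form 0 = 0" by (simp add: frame_form_def)
  ultimately show "P \<in> quadric frame_form" by (simp add: quadric_def pg_points_eq bit_pt_eq)
qed

lemma elliptic_quadric_frame_points: "elliptic_quadric (pt ` frame)"
  unfolding elliptic_quadric_def
proof (intro conjI ballI exI)
  have "frame_form (c *s v) = c\<^sup>2 * frame_form v" for c v
    by (simp only: frame_form_def vector_smult_component power2_eq_square algebra_simps)
  then show "quadratic_form frame_form"
    unfolding quadratic_form_def polar_frame_form using bilinear_jform by blast
  show "nonsingular frame_form"
    unfolding nonsingular_def polar_frame_form using jform_nondegenerate[OF bit_two] by blast
  show "pt ` frame = quadric frame_form" by (simp add: quadric_frame_form)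
  show "pt ` frame \<noteq> {}" by (simp add: frame_eq)
  fix L :: "(bit ^ 4) set" assume "L \<in> pg_lines"
  then obtain p q where pq: "L = bit_line p q" "p \<noteq> 0" "q \<noteq> 0" "p \<noteq> q"
    unfolding pg_lines_bit by (elim CollectE exE conjE)
  have "p + q \<noteq> 0" using pq by (simp add: bit_vec_add_eq_0_iff)
  show "\<not> points_on L \<subseteq> pt ` frame"
  proof
    assume "points_on L \<subseteq> pt ` frame"
    then have fr: "p \<in> frame" "q \<in> frame" "p + q \<in> frame"
      using pq \<open>p + q \<noteq> 0\<close> by (simp_all add: points_on_bit_line pt_in_frame_iff)
    then have "frame_form (p + q) = 1"
      using jform_frame[OF fr(1,2) pq(4)] by (simp add: frame_form_add frame_def)
    then show False using fr(3) by (simp add: frame_def)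
  qed
qed

text \<open>The values of \<open>frame_form\<close> at the three points of a line add up to
  \<open>jform p q\<close>. If this is 0, the number of zeros is 1 or 3, and 3 is impossible as two
  frame vectors have product 1; otherwise it is 0 or 2.\<close>

lemma card_line_frame:
  assumes "p \<noteq> 0" "q \<noteq> 0" "p \<noteq> q"
  shows "card ({p, q, p + q} \<inter> frame) = 1 \<longleftrightarrow> jform p q = 0"
proof -
  have nz: "p + q \<noteq> 0" "p + q \<noteq> p" "p + q \<noteq> q" using assms by (auto simp: bit_vec_add_eq_0_iff)
  have fr: "p \<in> frame \<longleftrightarrow> frame_form p = 0" "q \<in> frame \<longleftrightarrow> frame_form q = 0"
    "p + q \<in> frame \<longleftrightarrow> frame_form p + frame_form q + jform p q = 0"
    using assms nz by (simp_all only: frame_def frame_form_add mem_Collect_eq simp_thms)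
  have not3: "jform p q = 1" if "frame_form p = 0" "frame_form q = 0"
    using jform_frame[of p q] that fr assms by blast
  show ?thesis
    using fr not3 nz assms
    by (cases "frame_form p"; cases "frame_form q"; cases "jform p q") (simp_all add: Int_insert_left)
qed

lemma totally_isotropic_bit_line: "bit_line p q \<subseteq> form_perp jform (bit_line p q) \<longleftrightarrow> jform p q = 0"
proof -
  have "jform (0::bit ^ 4) x = 0" "jform x (0::bit ^ 4) = 0" for x by (simp_all add: jform_def)
  then show ?thesis
    using jform_self[OF bit_two] jform_commute[of q p]
    by (auto simp: bit_line_def form_perp_def jform_add_left jform_add_right)
qed

context hermitian_space
begin

lemma frame_lines_eq:
  assumes "invertible M"
  shows "baer_line M ` {L \<in> pg_lines. L \<subseteq> form_perp jform L} =
    {l \<in> baer_lines M. card (l \<inter> frame_points M) = 1}"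
proof -
  have "card (baer_line M L \<inter> frame_points M) = 1 \<longleftrightarrow> L \<subseteq> form_perp jform L" if "L \<in> pg_lines" for L
  proof -
    obtain p q where pq: "L = bit_line p q" "p \<noteq> 0" "q \<noteq> 0" "p \<noteq> q"
      using \<open>L \<in> pg_lines\<close> unfolding pg_lines_bit by (elim CollectE exE conjE)
    have nz: "p + q \<noteq> 0" using pq by (simp add: bit_vec_add_eq_0_iff)
    have inj: "inj_on (\<lambda>x. pt (baer_vec M x)) (- {0})"
      using pt_baer_vec_eq_iff[OF assms] by (auto intro!: inj_onI)
    have "baer_line M L = (\<lambda>x. pt (baer_vec M x)) ` {p, q, p + q}"
      by (simp add: pq baer_line_eq line3_def baer_vec_add)
    then have "baer_line M L \<inter> frame_points M = (\<lambda>x. pt (baer_vec M x)) ` ({p, q, p + q} \<inter> frame)"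
      unfolding frame_points_def using pq nz frame_neq_0
      by (simp only:) (rule inj_on_image_Int[OF inj, symmetric]; auto)
    then have "card (baer_line M L \<inter> frame_points M) = card ({p, q, p + q} \<inter> frame)"
      using card_image[OF inj_on_subset[OF inj], of "{p, q, p + q} \<inter> frame"] frame_neq_0 by auto
    then show ?thesis using card_line_frame pq totally_isotropic_bit_line by simp
  qed
  then show ?thesis unfolding baer_lines_def by blast
qed


text \<open>These are the semilinear involution and the form of the symplectic polarity that turn the
  frame of a Gram matrix into an ovoid of a symplectic subquadrangle.\<close>

definition baer_conj :: "'a ^ 4 ^ 4 \<Rightarrow> 'a ^ 4 \<Rightarrow> 'a ^ 4" where
  "baer_conj M v = M *v conj_vec (matrix_inv M *v v)"

definition baer_form :: "'a ^ 4 ^ 4 \<Rightarrow> 'a ^ 4 \<Rightarrow> 'a ^ 4 \<Rightarrow> 'a" where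
  "baer_form M u v = jform (matrix_inv M *v u) (matrix_inv M *v v)"

lemma matrix_inv_vec:
  assumes "invertible M"
  shows "matrix_inv M *v (M *v x) = (x :: 'a ^ 4)"
proof -
  have "M ** matrix_inv M = mat 1 \<and> matrix_inv M ** M = mat 1"
    using assms unfolding invertible_def matrix_inv_def by (rule someI_ex)
  then show ?thesis by (simp add: matrix_vector_mul_assoc)
qed

lemma baer_conj_mult: "invertible M \<Longrightarrow> baer_conj M (M *v x) = M *v conj_vec x"
  by (simp add: baer_conj_def matrix_inv_vec)

lemma baer_form_mult: "invertible M \<Longrightarrow> baer_form M (M *v x) (M *v y) = jform x y"
  by (simp add: baer_form_def matrix_inv_vec)

lemma bilinear_baer_form: "bilinear_form (baer_form M)"
  by (simp add: bilinear_form_def linear_form_iff baer_form_def matrix_vector_right_distrib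
      vector_scalar_commute jform_add_left jform_add_right jform_scale_left jform_scale_right)

lemma nondegenerate_baer_form:
  assumes "invertible M"
  shows "nondegenerate (baer_form M)"
  unfolding nondegenerate_def
proof (intro allI impI)
  fix u assume u: "\<forall>v. baer_form M u v = 0"
  obtain x where x: "u = M *v x" using assms by (rule invertible_surj)
  have "jform x y = 0" for y using u baer_form_mult[OF assms, of x y] by (simp add: x)
  then have "x = 0" by (rule jform_nondegenerate[OF two])
  then show "u = 0" by (simp add: x)
qed

lemma baer_conj_baer_conj:
  assumes "invertible M"
  shows "baer_conj M (baer_conj M v) = v"
proof -
  obtain x where "v = M *v x" using assms by (rule invertible_surj)
  then show ?thesis by (simp add: baer_conj_mult[OF assms])
qed

lemma baer_conj_add: "baer_conj M (u + v) = baer_conj M u + baer_conj M v"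
  by (simp add: baer_conj_def matrix_vector_right_distrib conj_vec_add)

lemma baer_conj_scale: "baer_conj M (c *s v) = c\<^sup>2 *s baer_conj M v"
  by (simp add: baer_conj_def vector_scalar_commute conj_vec_scale)

lemma conj_jform: "jform (conj_vec x) y = (jform x (conj_vec y))\<^sup>2"
  by (simp add: jform_def conj_vec_def sq_add power_mult_distrib)

lemma baer_form_conj_left: "baer_form M (baer_conj M u) v = (baer_form M u (baer_conj M v))\<^sup>2"
  if "invertible M"
  using that by (simp add: baer_form_def baer_conj_def matrix_inv_vec conj_jform)

text \<open>The source of the relation between the polarities: the unitary polar of \<open>U\<close>
  is the conjugate of its symplectic polar, so composing the two polarities leaves the
  conjugation.\<close>

lemma h_eq_baer_form:
  assumes "gram M"
  shows "h u v = baer_form M u (baer_conj M v)"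
proof -
  note inv = gram_invertible[OF assms]
  obtain x where x: "u = M *v x" using inv by (rule invertible_surj)
  obtain y where y: "v = M *v y" using inv by (rule invertible_surj)
  show ?thesis
    unfolding x y by (simp add: baer_conj_mult[OF inv] baer_form_mult[OF inv] gram_mult[OF assms])
qed

lemma baer_form_perp_conj:
  assumes "invertible M"
  shows "form_perp (baer_form M) (baer_conj M ` U) = baer_conj M ` form_perp (baer_form M) U"
proof (intro equalityI subsetI)
  fix v assume "v \<in> form_perp (baer_form M) (baer_conj M ` U)"
  then have "baer_conj M v \<in> form_perp (baer_form M) U"
    using baer_form_conj_left[OF assms] by (simp add: form_perp_def)
  then show "v \<in> baer_conj M ` form_perp (baer_form M) U"
    using baer_conj_baer_conj[OF assms, of v] by (metis imageI)
next
  fix v assume "v \<in> baer_conj M ` form_perp (baer_form M) U"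
  then obtain v' where "v = baer_conj M v'" "v' \<in> form_perp (baer_form M) U" by blast
  then show "v \<in> form_perp (baer_form M) (baer_conj M ` U)"
    by (simp add: form_perp_def baer_form_conj_left[OF assms] baer_conj_baer_conj[OF assms])
qed

lemma form_perp_h:
  assumes "gram M"
  shows "form_perp h U = baer_conj M ` form_perp (baer_form M) U"
proof (intro equalityI subsetI)
  note cc = baer_conj_baer_conj[OF gram_invertible[OF assms]]
  fix v assume "v \<in> form_perp h U"
  then have "baer_conj M v \<in> form_perp (baer_form M) U"
    by (simp add: form_perp_def h_eq_baer_form[OF assms])
  then show "v \<in> baer_conj M ` form_perp (baer_form M) U" using cc[of v] by (metis imageI)
next
  note cc = baer_conj_baer_conj[OF gram_invertible[OF assms]]
  fix v assume "v \<in> baer_conj M ` form_perp (baer_form M) U"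
  then show "v \<in> form_perp h U" by (auto simp: form_perp_def h_eq_baer_form[OF assms] cc)
qed

lemma baer_form_represents:
  assumes "invertible M" "Vector_Spaces.linear (*s) (*) g"
  obtains z where "\<And>u. g u = baer_form M u z"
proof -
  define k where "k i = g (column i M)" for i
  let ?S = "k 1 + k 2 + k 3 + k 4"
  \<comment> \<open>In characteristic 2 the matrix J + I of \<open>jform\<close> is its own inverse,
    since the square of J is 4J = 0. Applying it to the values \<open>k i\<close> adds their sum to
    each.\<close>
  define z where "z = M *v (\<chi> i. k i + ?S)"
  have "g u = baer_form M u z" for u
  proof -
    obtain x where x: "u = M *v x" using assms(1) by (rule invertible_surj)
    have "g u = x$1 * k 1 + x$2 * k 2 + x$3 * k 3 + x$4 * k 4"
      using assms(2) unfolding linear_form_iff x matrix_mult_sum sum_4 k_def by simp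
    moreover have "k 2 + ?S + (k 3 + ?S) + (k 4 + ?S) = k 1" "k 1 + ?S + (k 3 + ?S) + (k 4 + ?S) = k 2"
      "k 1 + ?S + (k 2 + ?S) + (k 4 + ?S) = k 3" "k 1 + ?S + (k 2 + ?S) + (k 3 + ?S) = k 4"
      by (simp_all add: ac_simps)
    ultimately show ?thesis
      by (simp only: x z_def baer_form_mult[OF assms(1)] jform_def vec_lambda_beta)
  qed
  then show ?thesis using that by blast
qed

lemma baer_form_alternating: "baer_form M v v = 0"
  by (simp add: baer_form_def jform_self[OF two])

text \<open>A vector outside \<open>U\<close> is separated from \<open>U\<close> by a linear
  functional. The form represents it by some \<open>z\<close>, which is orthogonal to
  \<open>U\<close> but not to that vector.\<close>

lemma double_perp:
  assumes "invertible M" "vec.subspace U"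
  shows "form_perp (baer_form M) (form_perp (baer_form M) U) = U"
proof (intro equalityI subsetI)
  fix v assume v: "v \<in> form_perp (baer_form M) (form_perp (baer_form M) U)"
  show "v \<in> U"
  proof (rule ccontr)
    assume "v \<notin> U"
    then obtain g where g: "Vector_Spaces.linear (*s) (*) g" "\<And>u. u \<in> U \<Longrightarrow> g u = 0" "g v = 1"
      using ex_separating_functional[OF assms(2)] by blast
    obtain z where z: "\<And>u. g u = baer_form M u z"
      by (rule baer_form_represents[OF assms(1) g(1)]) (rule that)
    have "z \<in> form_perp (baer_form M) U" using g(2) z by (simp add: form_perp_def)
    then have "baer_form M z v = 0" using v by (simp add: form_perp_def)
    moreover have "baer_form M v z = 1" using g(3) z by simp
    ultimately show False by (simp add: baer_form_def jform_commute[of "matrix_inv M *v z"])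
  qed
next
  fix v assume "v \<in> U"
  then show "v \<in> form_perp (baer_form M) (form_perp (baer_form M) U)"
    by (auto simp: form_perp_def baer_form_def) (metis jform_commute)
qed

lemma extends_polarity_baer_form:
  assumes inv: "invertible M"
  shows "extends_polarity M (form_perp jform) (form_perp (baer_form M))"
  unfolding extends_polarity_def
proof (intro allI impI equalityI subsetI)
  fix U :: "(bit ^ 4) set" and v
  assume v: "v \<in> form_perp (baer_form M) (baer_ext M U)"
  then have "v \<in> form_perp (baer_form M) (baer_vec M ` U)"
    by (simp only: form_perp_span[OF bilinear_baer_form] baer_ext_def)
  then have v: "baer_form M (baer_vec M x) v = 0" if "x \<in> U" for x
    using that by (simp add: form_perp_def)
  obtain y where y: "v = M *v y" using inv by (rule invertible_surj)
  obtain a b where ab: "y = bit_vec a + w *s bit_vec b" by (rule bit_vec_decompose)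
  \<comment> \<open>The two binary parts of \<open>v\<close> are orthogonal to \<open>U\<close>
    separately, because 1 and \<open>w\<close> are independent over the prime field.\<close>
  have "jform x a = 0 \<and> jform x b = 0" if "x \<in> U" for x
  proof (rule bit_pair_eq_0)
    show "of_bit (jform x a) + w * of_bit (jform x b) = 0"
      using v[OF that] unfolding y ab baer_vec_eq baer_form_mult[OF inv]
      by (simp only: jform_add_right jform_scale_right jform_bit_vec)
  qed
  then have "a \<in> form_perp jform U" "b \<in> form_perp jform U" by (simp_all add: form_perp_def)
  moreover have "v = baer_vec M a + w *s baer_vec M b"
    by (simp add: y ab baer_vec_eq matrix_vector_right_distrib vector_scalar_commute)
  ultimately show "v \<in> baer_ext M (form_perp jform U)"
    unfolding baer_ext_def
    by (simp only:) (rule vec.span_add[OF vec.span_base vec.span_scale[OF vec.span_base]]; simp)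
next
  fix U :: "(bit ^ 4) set" and v
  assume "v \<in> baer_ext M (form_perp jform U)"
  moreover have "baer_vec M ` form_perp jform U \<subseteq> form_perp (baer_form M) (baer_ext M U)"
    unfolding baer_ext_def form_perp_span[OF bilinear_baer_form]
    by (auto simp: form_perp_def baer_vec_eq baer_form_mult[OF inv] jform_bit_vec)
  ultimately show "v \<in> form_perp (baer_form M) (baer_ext M U)"
    using vec.span_minimal[OF _ form_perp_subspace[OF bilinear_baer_form]]
    unfolding baer_ext_def by blast
qed

lemma image_baer_conj_pt: "baer_conj M ` pt v = pt (baer_conj M v)"
proof -
  have "\<exists>d. c = d\<^sup>2" for c :: 'a using sq_sq by metis
  then show ?thesis
    by (auto simp: vec.span_singleton image_iff baer_conj_scale)
qed

lemma fixed_points_baer_conj: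
  assumes inv: "invertible M"
  shows "{P \<in> pg_points. baer_conj M ` P = P} = baer_points M"
proof (intro equalityI subsetI)
  fix P assume "P \<in> {P \<in> pg_points. baer_conj M ` P = P}"
  then have P: "P \<in> pg_points" "baer_conj M ` P = P" by simp_all
  then obtain v where v: "v \<noteq> 0" "P = pt v" unfolding pg_points_eq by blast
  have "pt (baer_conj M v) = pt v" using P(2) by (simp add: v(2) image_baer_conj_pt)
  then obtain c where c: "baer_conj M v = c *s v" using pt_eq_iff[OF v(1)] by blast
  obtain y where y: "v = M *v y" using inv by (rule invertible_surj)
  have "M *v (conj_vec y + c *s y) = 0"
    using c by (simp add: y baer_conj_mult[OF inv] matrix_vector_right_distrib vector_scalar_commute)
  then have "conj_vec y + c *s y = 0" by (rule invertible_mult_eq_0[OF inv])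
  then have cy: "conj_vec y = c *s y" by (simp only: vec_add_eq_0_iff)
  have "y \<noteq> 0" using v(1) y by auto
  then obtain i where i: "y$i \<noteq> 0" by (auto simp: vec_eq_iff)
  \<comment> \<open>Scaling one coordinate to 1 turns proportionality of \<open>y\<close> and its
    conjugate into equality, so all coordinates become 0 or 1.\<close>
  define k where "k = inverse (y$i)"
  have "k \<noteq> 0" using i by (simp add: k_def)
  have sq: "(y$j)\<^sup>2 = c * y$j" for j using cy by (simp add: vec_eq_iff conj_vec_def)
  have "c = y$i" using sq[of i] i by (simp add: power2_eq_square)
  then have "(k * y$j)\<^sup>2 = k * y$j" for j
    using i sq[of j] by (simp add: k_def power2_eq_square field_simps)
  then have "k * y$j = 0 \<or> k * y$j = 1" for j by (metis sq_eq_self_iff)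
  then have ky: "k *s y = bit_vec (\<chi> j. if k * y$j = 1 then 1 else 0)"
    by (auto simp: vec_eq_iff bit_vec_def)
  define x :: "bit ^ 4" where "x = (\<chi> j. if k * y$j = 1 then 1 else 0)"
  have kv: "k *s v = baer_vec M x"
    using ky by (simp add: x_def y baer_vec_eq flip: vector_scalar_commute)
  then have "x \<noteq> 0" using \<open>k \<noteq> 0\<close> v(1) by auto
  moreover have "P = pt (baer_vec M x)"
    unfolding v(2) kv[symmetric] using pt_eq_iff[OF v(1)] \<open>k \<noteq> 0\<close> by blast
  ultimately show "P \<in> baer_points M"
    unfolding baer_points_eq[OF inv] span_points_def using baer_vec_nonzero[OF inv] by blast
next
  fix P assume "P \<in> baer_points M"
  then obtain x where "P = pt (baer_vec M x)" "baer_vec M x \<noteq> 0"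
    unfolding baer_points_eq[OF inv] span_points_def by blast
  moreover have "baer_conj M (baer_vec M x) = baer_vec M x"
    by (simp add: baer_vec_eq baer_conj_mult[OF inv] conj_vec_bit_vec)
  ultimately show "P \<in> {P \<in> pg_points. baer_conj M ` P = P}"
    by (simp add: pg_points_eq image_baer_conj_pt)
qed

lemma semilinear_involution_baer_conj:
  assumes inv: "invertible M"
  shows "semilinear_involution (baer_conj M)"
proof -
  have bij: "bij (baer_conj M)"
    by (rule involuntory_imp_bij) (rule baer_conj_baer_conj[OF inv])
  have bij_sq: "bij (\<lambda>c::'a. c\<^sup>2)"
    by (rule involuntory_imp_bij) (rule sq_sq)
  have "semilinear_bij (baer_conj M)"
    unfolding semilinear_bij_def
    by (intro conjI allI exI[of _ "\<lambda>c. c\<^sup>2"])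
      (rule bij bij_sq baer_conj_add baer_conj_scale sq_add power_mult_distrib)+
  moreover have "baer_conj M ` baer_conj M ` U = U" for U
    by (simp add: image_image baer_conj_baer_conj[OF inv])
  moreover have "\<exists>U. vec.subspace U \<and> baer_conj M ` U \<noteq> U"
  proof -
    \<comment> \<open>A point outside the subgeometry: the first coordinate forces the scalar 1, but
      \<open>w\<close> differs from its square.\<close>
    let ?x = "axis 1 1 + w *s axis 2 1 :: 'a ^ 4"
    have "baer_conj M ` pt (M *v ?x) \<noteq> pt (M *v ?x)"
    proof
      assume "baer_conj M ` pt (M *v ?x) = pt (M *v ?x)"
      then have "pt (M *v conj_vec ?x) = pt (M *v ?x)"
        by (simp only: image_baer_conj_pt baer_conj_mult[OF inv])
      then have "M *v conj_vec ?x \<in> pt (M *v ?x)"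
        using vec.span_base[of "M *v conj_vec ?x" "{M *v conj_vec ?x}"] by simp
      then obtain c where "M *v conj_vec ?x = c *s (M *v ?x)" unfolding in_pt_iff by blast
      then have "M *v (conj_vec ?x + c *s ?x) = 0"
        by (simp add: matrix_vector_right_distrib vector_scalar_commute)
      then have "conj_vec ?x + c *s ?x = 0" by (rule invertible_mult_eq_0[OF inv])
      then have eq: "conj_vec ?x = c *s ?x" by (simp only: vec_add_eq_0_iff)
      have "c = 1" using arg_cong[OF eq, of "\<lambda>x. x$1"] by (simp add: conj_vec_def axis_def)
      moreover have "w\<^sup>2 = c * w" using arg_cong[OF eq, of "\<lambda>x. x$2"] by (simp add: conj_vec_def axis_def)
      ultimately show False using w_nz by (simp add: power2_eq_square)
    qed
    then show ?thesis using vec.subspace_span by blast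
  qed
  ultimately show ?thesis by (simp add: semilinear_involution_def)
qed

lemma gram_subquadrangle:
  assumes g: "gram M"
  defines "W \<equiv> (baer_points M, {l \<in> baer_lines M. card (l \<inter> frame_points M) = 1})"
  shows "symplectic_subquadrangle (form_perp h) W" "elliptic_ovoid W (frame_points M)"
proof -
  note inv = gram_invertible[OF g]
  show "elliptic_ovoid W (frame_points M)"
    unfolding elliptic_ovoid_def W_def
    using inv elliptic_quadric_frame_points
    by (intro exI[of _ M] exI[of _ "pt ` frame"]) (simp add: frame_points_def image_image baer_ext_pt)
  have "nondegenerate (jform :: bit ^ 4 \<Rightarrow> _)"
    unfolding nondegenerate_def using jform_nondegenerate[OF bit_two] by blast
  then have 1: "symplectic_polarity (form_perp (jform :: bit ^ 4 \<Rightarrow> _))"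
    unfolding symplectic_polarity_def using bilinear_jform jform_self[OF bit_two] by blast
  have 2: "symplectic_polarity (form_perp (baer_form M))"
    unfolding symplectic_polarity_def
    using bilinear_baer_form nondegenerate_baer_form[OF inv] baer_form_alternating by blast
  have 3: "W = symplectic_quadrangle M (form_perp jform)"
    by (simp add: W_def symplectic_quadrangle_def frame_lines_eq[OF inv])
  have 4: "form_perp (baer_form M) (form_perp h U) = baer_conj M ` U \<and>
      form_perp h (form_perp (baer_form M) U) = baer_conj M ` U" if "vec.subspace U" for U
    by (simp add: form_perp_h[OF g] baer_form_perp_conj[OF inv] double_perp[OF inv that])
  show "symplectic_subquadrangle (form_perp h) W"
    unfolding symplectic_subquadrangle_def
    by (rule exI[of _ M], rule exI[of _ "form_perp jform"], rule exI[of _ "form_perp (baer_form M)"],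
        rule exI[of _ "baer_conj M"])
      (intro conjI allI impI inv 1 2 3 extends_polarity_baer_form semilinear_involution_baer_conj
        fixed_points_baer_conj 4[THEN conjunct1] 4[THEN conjunct2])
qed

end

section \<open>Coordinates with respect to an ovoid\<close>

lemma f4_mult_eq_0_iff: "f4_mult a b = F0 \<longleftrightarrow> a = F0 \<or> b = F0"
  by (cases a; cases b) simp_all

lemma f4_mult_assoc: "f4_mult (f4_mult a b) c = f4_mult a (f4_mult b c)"
  by (cases a; cases b; cases c) simp_all

lemma f4_mult_commute: "f4_mult a b = f4_mult b a"
  by (cases a; cases b) simp_all

lemma f4_mult_left_commute: "f4_mult a (f4_mult b c) = f4_mult b (f4_mult a c)"
  by (cases a; cases b; cases c) simp_all

lemmas f4_mult_ac = f4_mult_assoc f4_mult_commute f4_mult_left_commute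

lemma f4_conj_mult: "f4_conj (f4_mult a b) = f4_mult (f4_conj a) (f4_conj b)"
  by (cases a; cases b) simp_all

lemma f4_conj_conj [simp]: "f4_conj (f4_conj a) = a"
  by (cases a) simp_all

lemma f4_conj_eq_0_iff [simp]: "f4_conj a = F0 \<longleftrightarrow> a = F0"
  by (cases a) simp_all

lemma f4_norm: "a \<noteq> F0 \<Longrightarrow> f4_mult a (f4_conj a) = F1"
  by (cases a) simp_all

lemma f4_norm_product:
  assumes "a \<noteq> F0" "b \<noteq> F0" "c \<noteq> F0"
  shows "f4_mult (f4_mult a (f4_conj b)) (f4_mult (f4_mult b (f4_conj c)) (f4_mult c (f4_conj a))) = F1"
  using assms by (cases a; cases b; cases c) simp_all

lemma f4_mult_1 [simp]: "f4_mult F1 a = a" "f4_mult a F1 = a"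
  by (cases a; simp)+

lemma f4_mult_0 [simp]: "f4_mult a F0 = F0"
  by (cases a) simp_all

lemma f4_mult_add_right: "f4_mult k (f4_add a b) = f4_add (f4_mult k a) (f4_mult k b)"
  by (cases k; cases a; cases b) simp_all

lemma f4_mult_add_left: "f4_mult (f4_add a b) k = f4_add (f4_mult a k) (f4_mult b k)"
  by (cases k; cases a; cases b) simp_all

lemma f4_conj_add: "f4_conj (f4_add a b) = f4_add (f4_conj a) (f4_conj b)"
  by (cases a; cases b) simp_all

lemma herm_scale_left: "herm (vec_scale k x) y = f4_mult k (herm x y)"
  by (cases x; cases y) (simp add: f4_mult_add_right f4_mult_add_left f4_mult_assoc)

lemma herm_sym: "f4_conj (herm x y) = herm y x"
  by (cases x; cases y) (simp add: f4_conj_mult f4_conj_add f4_mult_commute)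

lemma herm_scale_right: "herm x (vec_scale k y) = f4_mult (f4_conj k) (herm x y)"
proof -
  have "herm x (vec_scale k y) = f4_conj (f4_mult k (herm y x))"
    by (simp only: herm_sym flip: herm_scale_left)
  then show ?thesis by (simp only: f4_conj_mult herm_sym)
qed

abbreviation zero_f4_vec :: f4_vec where "zero_f4_vec \<equiv> (F0, F0, F0, F0)"

lemma vec_scale_eq_0_iff: "k \<noteq> F0 \<Longrightarrow> vec_scale k x = zero_f4_vec \<longleftrightarrow> x = zero_f4_vec"
  by (cases x) (simp add: f4_mult_eq_0_iff)

lemma normalize_vec_scale: "k \<noteq> F0 \<Longrightarrow> normalize_vec (vec_scale k x) = normalize_vec x"
proof -
  assume k: "k \<noteq> F0"
  then have "f4_mult (f4_conj (f4_mult k a)) (f4_mult k b) = f4_mult (f4_conj a) b" for a b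
    by (cases k; cases a; cases b) simp_all
  then show ?thesis using k by (cases x) (simp add: f4_mult_eq_0_iff)
qed

lemma normalize_vec_eq_scale:
  assumes "x \<noteq> zero_f4_vec"
  obtains k where "k \<noteq> F0" "normalize_vec x = vec_scale k x"
proof -
  obtain a b c d where x: "x = (a, b, c, d)" by (cases x)
  let ?k = "f4_conj (if a \<noteq> F0 then a else if b \<noteq> F0 then b else if c \<noteq> F0 then c else d)"
  have "?k \<noteq> F0" using assms x by (auto split: if_splits)
  moreover have "normalize_vec x = vec_scale ?k x" by (simp add: x)
  ultimately show ?thesis by (rule that)
qed

lemma set_surface_points:
  "set surface_points = {x. x \<noteq> zero_f4_vec \<and> normalize_vec x = x \<and> herm x x = F0}"
proof -
  have "a \<in> set [F0, F1, Fw, Fv]" for a by (cases a) simp_all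
  then have "set [F0, F1, Fw, Fv] = UNIV" by blast
  then have U: "set (List.product [F0, F1, Fw, Fv] (List.product [F0, F1, Fw, Fv]
      (List.product [F0, F1, Fw, Fv] [F0, F1, Fw, Fv]))) = UNIV"
    by (simp only: List.set_product UNIV_Times_UNIV)
  show ?thesis unfolding surface_points_def Let_def set_filter U by simp
qed

lemma distinct_surface_points: "distinct surface_points"
  unfolding surface_points_def Let_def by (intro distinct_filter distinct_product) simp_all

text \<open>Hence a subsequence of \<open>surface_points\<close> is determined by its set, so
  enumerated lists stand for sets of points.\<close>

lemma subseq_eq_filter:
  assumes "subseq l xs" "distinct xs"
  shows "l = filter (\<lambda>x. x \<in> set l) xs"
  using assms
proof (induction xs arbitrary: l rule: list.induct)
  case (Cons x xs)
  show ?case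
  proof (cases "\<exists>l'. l = x # l' \<and> subseq l' xs")
    case True
    then obtain l' where l': "l = x # l'" "subseq l' xs" by blast
    have "filter (\<lambda>y. y \<in> set l) xs = filter (\<lambda>y. y \<in> set l') xs"
      using Cons.prems(2) l'(1) by (intro filter_cong) auto
    also have "\<dots> = l'" using Cons.IH[OF l'(2)] Cons.prems(2) by simp
    finally show ?thesis using l'(1) by simp
  next
    case False
    then have sub: "subseq l xs" using Cons.prems(1) by (cases l) (auto split: if_splits)
    then have "x \<notin> set l" using Cons.prems(2) by (auto dest: list_emb_set)
    then show ?thesis using Cons.IH[OF sub] Cons.prems(2) by simp
  qed
qed simp

lemma sorted_wrt_if_pairwise:
  assumes "distinct xs" "\<And>x y. \<lbrakk>x \<in> set xs; y \<in> set xs; x \<noteq> y\<rbrakk> \<Longrightarrow> R x y"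
  shows "sorted_wrt R xs"
  using assms by (induction xs) auto

lemma length_5E:
  assumes "length l = 5"
  obtains a b c d e where "l = [a, b, c, d, e]"
  using assms by (auto simp: numeral_eq_Suc length_Suc_conv)

lemma ovoid0_in_ovoid_lists: "ovoid0 \<in> set (ovoid_lists surface_points)"
  unfolding ovoid_lists_iff by code_simp

text \<open>Listed as single frame vectors and sums of two, in the order that
  \<open>pair_sums\<close> produces.\<close>

lemma nonzero_bit_vecs:
  "(- {0} :: (bit ^ 4) set) = {axis 1 1, axis 1 1 + axis 2 1, axis 1 1 + axis 3 1,
     axis 1 1 + axis 4 1, axis 1 1 + 1, axis 2 1, axis 2 1 + axis 3 1, axis 2 1 + axis 4 1,
     axis 2 1 + 1, axis 3 1, axis 3 1 + axis 4 1, axis 3 1 + 1, axis 4 1, axis 4 1 + 1, 1}"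
proof -
  have "x \<in> - {0} \<longleftrightarrow> x \<in> {axis 1 1, axis 1 1 + axis 2 1, axis 1 1 + axis 3 1,
     axis 1 1 + axis 4 1, axis 1 1 + 1, axis 2 1, axis 2 1 + axis 3 1, axis 2 1 + axis 4 1,
     axis 2 1 + 1, axis 3 1, axis 3 1 + axis 4 1, axis 3 1 + 1, axis 4 1, axis 4 1 + 1, 1}" for x :: "bit ^ 4"
    by (cases "x$1"; cases "x$2"; cases "x$3"; cases "x$4")
       (simp_all add: vec_eq_iff forall_4 axis_def)
  then show ?thesis by blast
qed

section \<open>Translation between the enumeration and the projective space\<close>

context hermitian_space
begin

fun f4_emb :: "f4 \<Rightarrow> 'a" where
  "f4_emb F0 = 0" | "f4_emb F1 = 1" | "f4_emb Fw = w" | "f4_emb Fv = 1 + w"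

lemma f4_emb_add: "f4_emb (f4_add a b) = f4_emb a + f4_emb b"
  by (cases a; cases b) (simp_all add: add.left_commute add.commute)

lemma f4_emb_mult: "f4_emb (f4_mult a b) = f4_emb a * f4_emb b"
  by (cases a; cases b) (simp_all add: w_sq field_mult)

lemma f4_emb_conj: "f4_emb (f4_conj a) = (f4_emb a)\<^sup>2"
  by (cases a) (simp_all add: power2_eq_square w_sq field_mult)

lemma f4_emb_eq_iff [simp]: "f4_emb a = f4_emb b \<longleftrightarrow> a = b"
  using w_nz one_add_w by (cases a; cases b) auto

lemma f4_emb_surj: obtains a where "x = f4_emb a"
  by (cases x rule: field_cases) (metis f4_emb.simps)+

lemma f4_emb_eq_consts [simp]: "f4_emb a = 0 \<longleftrightarrow> a = F0" "f4_emb a = 1 \<longleftrightarrow> a = F1"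
  using f4_emb_eq_iff[of a F0] f4_emb_eq_iff[of a F1] by simp_all

fun vec_emb :: "f4_vec \<Rightarrow> 'a ^ 4" where
  "vec_emb (a, b, c, d) =
     (\<chi> i. if i = 1 then f4_emb a else if i = 2 then f4_emb b else if i = 3 then f4_emb c else f4_emb d)"

lemma vec_emb_add: "vec_emb (vec_add x y) = vec_emb x + vec_emb y"
  by (cases x; cases y) (simp add: vec_eq_iff f4_emb_add)

lemma vec_emb_scale: "vec_emb (vec_scale k x) = f4_emb k *s vec_emb x"
  by (cases x) (simp add: vec_eq_iff f4_emb_mult)

lemma vec_emb_eq_iff [simp]: "vec_emb x = vec_emb y \<longleftrightarrow> x = y"
  by (cases x; cases y) (auto simp: vec_eq_iff forall_4)

lemma vec_emb_surj: obtains x where "v = vec_emb x"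
proof -
  obtain a b c d where "v$1 = f4_emb a" "v$2 = f4_emb b" "v$3 = f4_emb c" "v$4 = f4_emb d"
    by (metis f4_emb_surj)
  then have "v = vec_emb (a, b, c, d)" by (simp add: vec_eq_iff forall_4)
  then show ?thesis by (rule that)
qed

text \<open>The product of the coordinate sums contains each diagonal term once, and in
  characteristic 2 adding it removes it. This is the shape in which \<open>herm\<close> is
  computed.\<close>

lemma jform_alt: "jform x y = (x$1 + x$2 + x$3 + x$4) * (y$1 + y$2 + y$3 + y$4) +
    (x$1 * y$1 + x$2 * y$2 + x$3 * y$3 + x$4 * (y$4 :: 'a))"
proof -
  have "jform x y + (x$1 * y$1 + x$2 * y$2 + x$3 * y$3 + x$4 * y$4) =
      (x$1 + x$2 + x$3 + x$4) * (y$1 + y$2 + y$3 + y$4)"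
    by (simp add: jform_def algebra_simps)
  moreover have "p = r + q" if "p + q = r" for p q r :: 'a
    using that by (metis add.assoc add_self add.right_neutral)
  ultimately show ?thesis by blast
qed

lemma herm_emb: "jform (vec_emb x) (conj_vec (vec_emb y)) = f4_emb (herm x y)"
  by (cases x; cases y)
    (simp add: jform_alt conj_vec_def f4_emb_add f4_emb_mult f4_emb_conj sq_add add.assoc)

definition coord :: "'a ^ 4 ^ 4 \<Rightarrow> f4_vec \<Rightarrow> 'a ^ 4" where
  "coord M x = M *v vec_emb x"

lemma coord_add: "coord M (vec_add x y) = coord M x + coord M y"
  by (simp add: coord_def vec_emb_add matrix_vector_right_distrib)

lemma coord_scale: "coord M (vec_scale k x) = f4_emb k *s coord M x"
  by (simp add: coord_def vec_emb_scale vector_scalar_commute)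

lemma h_coord: "gram M \<Longrightarrow> h (coord M x) (coord M y) = f4_emb (herm x y)"
  by (simp add: coord_def gram_mult herm_emb)

lemma coord_eq_iff:
  assumes "invertible M"
  shows "coord M x = coord M y \<longleftrightarrow> x = y"
proof
  assume "coord M x = coord M y"
  then have "M *v (vec_emb x + vec_emb y) = 0" by (simp add: coord_def matrix_vector_right_distrib)
  then have "vec_emb x + vec_emb y = 0" by (rule invertible_mult_eq_0[OF assms])
  then show "x = y" by (simp add: vec_add_eq_0_iff)
qed simp

lemma coord_0 [simp]: "coord M zero_f4_vec = 0"
proof -
  have "vec_emb zero_f4_vec = 0" by (simp add: vec_eq_iff)
  then show ?thesis by (simp only: coord_def matrix_vector_mult_0_right)
qed

lemma coord_eq_0_iff: "invertible M \<Longrightarrow> coord M x = 0 \<longleftrightarrow> x = zero_f4_vec"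
  using coord_eq_iff[of M x zero_f4_vec] by simp

lemma coord_surj:
  assumes "invertible M"
  obtains x where "v = coord M x"
proof -
  obtain y where "v = M *v y" using assms by (rule invertible_surj)
  moreover obtain x where "y = vec_emb x" by (rule vec_emb_surj)
  ultimately show ?thesis using that by (simp add: coord_def)
qed

lemma pt_coord_scale: "k \<noteq> F0 \<Longrightarrow> pt (coord M (vec_scale k x)) = pt (coord M x)"
  using pt_eq_iff[of "coord M x"] unfolding coord_scale
  by (cases "coord M x = 0") (simp, metis f4_emb_eq_consts(1))

lemma pt_coord_normalize: "pt (coord M (normalize_vec x)) = pt (coord M x)"
proof (cases "x = zero_f4_vec")
  case False
  then obtain k where "k \<noteq> F0" "normalize_vec x = vec_scale k x" by (rule normalize_vec_eq_scale)
  then show ?thesis by (simp add: pt_coord_scale)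
qed simp

lemma pt_coord_eq_iff:
  assumes "invertible M" "x \<noteq> zero_f4_vec" "y \<noteq> zero_f4_vec"
  shows "pt (coord M x) = pt (coord M y) \<longleftrightarrow> normalize_vec x = normalize_vec y"
proof
  assume "pt (coord M x) = pt (coord M y)"
  then obtain c where c: "c \<noteq> 0" "coord M x = c *s coord M y"
    using pt_eq_iff assms coord_eq_0_iff by blast
  obtain k where k: "c = f4_emb k" by (rule f4_emb_surj)
  have "x = vec_scale k y" using c(2) coord_eq_iff[OF assms(1)] by (simp add: k flip: coord_scale)
  then show "normalize_vec x = normalize_vec y" using c(1) k normalize_vec_scale by simp
next
  assume "normalize_vec x = normalize_vec y"
  then show "pt (coord M x) = pt (coord M y)" by (metis pt_coord_normalize)
qed

definition point_set :: "'a ^ 4 ^ 4 \<Rightarrow> f4_vec list \<Rightarrow> ('a ^ 4) set set" where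
  "point_set M l = (\<lambda>x. pt (coord M x)) ` set l"

lemma inj_on_pt_coord:
  assumes "invertible M"
  shows "inj_on (\<lambda>x. pt (coord M x)) (set surface_points)"
  by (rule inj_onI) (simp add: pt_coord_eq_iff[OF assms] set_surface_points)

lemma card_point_set_Int:
  assumes "invertible M" "set l \<subseteq> set surface_points" "set l' \<subseteq> set surface_points"
  shows "card (point_set M l \<inter> point_set M l') = card (set l \<inter> set l')"
proof -
  have "point_set M l \<inter> point_set M l' = (\<lambda>x. pt (coord M x)) ` (set l \<inter> set l')"
    unfolding point_set_def
    by (rule inj_on_image_Int[OF inj_on_pt_coord[OF assms(1)] assms(2,3), symmetric])
  moreover have "inj_on (\<lambda>x. pt (coord M x)) (set l \<inter> set l')"
    by (rule inj_on_subset[OF inj_on_pt_coord[OF assms(1)]]) (use assms(2) in blast)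
  ultimately show ?thesis by (simp add: card_image)
qed

lemma baer_vec_one: "baer_vec M 1 = column 1 M + column 2 M + column 3 M + (column 4 M :: 'a ^ 4)"
proof -
  have "(1 :: bit ^ 4) = axis 1 1 + axis 2 1 + axis 3 1 + axis 4 1"
    by (simp add: vec_eq_iff forall_4 axis_def)
  then have "baer_vec M 1 = baer_vec M (axis 1 1 + axis 2 1 + axis 3 1 + axis 4 1)"
    by (rule arg_cong)
  then show ?thesis by (simp only: baer_vec_add baer_vec_axis)
qed

text \<open>The rescaled vectors of an enumerated list have pairwise products 1, so the first four
  of them are the columns of a new Gram matrix.\<close>

lemma point_set_ovoid:
  assumes M: "gram M" and l: "l \<in> set (ovoid_lists surface_points)"
  obtains M' where "gram M'" "frame_points M' = point_set M l"
    "baer_points M' = point_set M (quadrangle_list l)" "set (quadrangle_list l) \<subseteq> set surface_points"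
proof -
  have sub: "set l \<subseteq> set surface_points" and len: "length l = 5"
    using l by (auto simp: ovoid_lists_iff dest: list_emb_set)
  obtain a b c d e where l_eq: "l = [a, b, c, d, e]" using len by (rule length_5E)
  let ?s = "\<lambda>y. vec_scale (herm a y) y"
  have iso: "herm x x = F0" if "x \<in> set l" for x using that sub by (auto simp: set_surface_points)
  have nz: "herm a y \<noteq> F0" if "y \<in> {b, c, d, e}" for y
    using l that by (auto simp: ovoid_lists_iff l_eq)
  have ut: "unit_triple a b c" "unit_triple a b d" "unit_triple a b e" "unit_triple a c d"
      "unit_triple a c e" "unit_triple a d e"
    using l by (auto simp: ovoid_lists_iff l_eq)
  have a_s: "herm a (?s y) = F1" if "y \<in> {b, c, d, e}" for y
    using f4_norm[OF nz[OF that]] by (simp add: herm_scale_right f4_mult_commute)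
  have s_s: "herm (?s y) (?s z) = F1" if "unit_triple a y z" for y z
    using that by (simp add: unit_triple_def herm_scale_left herm_scale_right herm_sym f4_mult_ac)
  have s_iso: "herm (?s y) (?s y) = F0" if "y \<in> {b, c, d, e}" for y
    using iso[of y] that by (auto simp: herm_scale_left herm_scale_right l_eq)
  have rev: "herm z y = F1" if "herm y z = F1" for y z
    using herm_sym[of y z] that by simp
  define col where "col j = (if j = 1 then a else if j = 2 then ?s b else if j = 3 then ?s c else ?s d)"
    for j :: 4
  define M' :: "'a ^ 4 ^ 4" where "M' = (\<chi> i j. coord M (col j) $ i)"
  have colM: "column j M' = coord M (col j)" for j by (simp add: M'_def column_def vec_eq_iff)
  have herm_col: "herm (col i) (col j) = (if i = j then F0 else F1)" for i j
    using exhaust_4[of i] exhaust_4[of j] a_s s_s[OF ut(1)] s_s[OF ut(2)] s_s[OF ut(4)] s_iso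
      iso[of a] rev[OF a_s] rev[OF s_s[OF ut(1)]] rev[OF s_s[OF ut(2)]] rev[OF s_s[OF ut(4)]]
    by (elim disjE) (simp_all add: col_def l_eq)
  have gram': "gram M'"
    by (rule gramI) (simp add: colM h_coord[OF M] herm_col)
  have herm_e: "herm (?s e) (col j) = F1" for j
    using exhaust_4[of j] rev[OF a_s[of e]] rev[OF s_s[OF ut(3)]] rev[OF s_s[OF ut(5)]]
      rev[OF s_s[OF ut(6)]]
    by (elim disjE) (simp_all add: col_def)
  \<comment> \<open>The fifth vector and the sum of the columns both have product 1 with every
    column, the latter because 3 = 1. Their sum is orthogonal to a basis, hence zero.\<close>
  have e_eq: "coord M (?s e) = baer_vec M' 1"
  proof -
    define u where "u = coord M (?s e) + baer_vec M' 1"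
    have "h u (column j M') = 0" for j
      using exhaust_4[of j]
      by (elim disjE) (simp_all add: u_def baer_vec_one h_add_left colM h_coord[OF M] herm_e herm_col)
    then have col0: "h (column j M') u = 0" for j using h_eq_0_commute by blast
    have "u = 0"
    proof (rule h_nondeg_right)
      fix v
      obtain x where "v = M' *v x" using gram_invertible[OF gram'] by (rule invertible_surj)
      then show "h v u = 0" by (simp add: matrix_mult_sum sum_4 h_add_left h_scale_left col0)
    qed
    then show ?thesis by (simp only: u_def vec_add_eq_0_iff)
  qed
  have ax: "baer_vec M' (axis 1 1) = coord M a" "baer_vec M' (axis 2 1) = coord M (?s b)"
      "baer_vec M' (axis 3 1) = coord M (?s c)" "baer_vec M' (axis 4 1) = coord M (?s d)"
      "baer_vec M' 1 = coord M (?s e)"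
    by (simp_all add: baer_vec_axis colM col_def e_eq)
  have pt_s: "pt (coord M (?s y)) = pt (coord M y)" if "y \<in> {b, c, d, e}" for y
    by (rule pt_coord_scale) (rule nz[OF that])
  have 1: "frame_points M' = point_set M l"
    unfolding frame_points_def frame_eq point_set_def l_eq by (simp add: ax pt_s)
  have "baer_points M' = (\<lambda>x. pt (baer_vec M' x)) ` (- {0})"
    by (simp add: baer_points_def pg_points_eq image_image baer_ext_pt)
  also have "\<dots> = (\<lambda>x. pt (coord M x)) ` set (pair_sums (rescale l))"
    unfolding nonzero_bit_vecs l_eq by (simp add: baer_vec_add ax coord_add)
  also have "\<dots> = point_set M (quadrangle_list l)"
    by (simp add: point_set_def quadrangle_list_def image_image pt_coord_normalize)
  finally have 2: "baer_points M' = point_set M (quadrangle_list l)" .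
  have "coord M ` set (pair_sums (rescale l)) = baer_vec M' ` (- {0})"
    unfolding nonzero_bit_vecs l_eq by (simp add: baer_vec_add ax coord_add)
  have 3: "set (quadrangle_list l) \<subseteq> set surface_points"
  proof
    fix q assume "q \<in> set (quadrangle_list l)"
    then obtain p where p: "p \<in> set (pair_sums (rescale l))" "q = normalize_vec p"
      by (auto simp: quadrangle_list_def)
    then have "coord M p \<in> baer_vec M' ` (- {0})"
      using \<open>coord M ` set (pair_sums (rescale l)) = _\<close> by blast
    then obtain x where x: "x \<noteq> 0" "coord M p = baer_vec M' x" by blast
    then have "coord M p \<noteq> 0" using baer_vec_nonzero[OF gram_invertible[OF gram']] by simp
    then have p0: "p \<noteq> zero_f4_vec" by (metis coord_0)
    have "f4_emb (herm p p) = 0"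
      using gram' x(2) jform_self[of x] by (simp add: gram_def flip: h_coord[OF M])
    then have "herm p p = F0" by simp
    obtain k where k: "k \<noteq> F0" "normalize_vec p = vec_scale k p" using p0 by (rule normalize_vec_eq_scale)
    then show "q \<in> set surface_points"
      using p0 \<open>herm p p = F0\<close>
      by (simp add: set_surface_points p(2) vec_scale_eq_0_iff herm_scale_left herm_scale_right)
        (metis normalize_vec_scale)
  qed
  show ?thesis by (rule that[OF gram' 1 2 3])
qed

text \<open>Normalizing the five vectors changes them by scalars, which cancel in every cyclic
  triple product (\<open>f4_norm_product\<close>). Thus the search conditions survive.\<close>

lemma frame_points_in_point_sets:
  assumes M: "gram M" and M': "gram M'"
  obtains l where "l \<in> set (ovoid_lists surface_points)" "frame_points M' = point_set M l"
proof -
  note inv = gram_invertible[OF M]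
  have "\<forall>x. \<exists>y. baer_vec M' x = coord M y" using coord_surj[OF inv] by blast
  then obtain p where p: "\<And>x. baer_vec M' x = coord M (p x)" by metis
  have emb: "f4_emb (herm (p x) (p y)) = of_bit (jform x y)" for x y
    using M' by (simp add: gram_def p flip: h_coord[OF M])
  have herm_p: "herm (p x) (p y) = F1" if "x \<in> frame" "y \<in> frame" "x \<noteq> y" for x y
    using emb[of x y] jform_frame[OF that] by simp
  have iso: "herm (p x) (p x) = F0" for x
    using emb[of x x] jform_self[of x] by simp
  have p0: "p x \<noteq> zero_f4_vec" if "x \<in> frame" for x
    using p[of x] baer_vec_nonzero[OF gram_invertible[OF M'], of x] that by (auto simp: frame_def)
  have "\<forall>x\<in>frame. \<exists>k. k \<noteq> F0 \<and> normalize_vec (p x) = vec_scale k (p x)"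
    using normalize_vec_eq_scale[OF p0] by blast
  then obtain k where k: "\<And>x. x \<in> frame \<Longrightarrow> k x \<noteq> F0 \<and> normalize_vec (p x) = vec_scale (k x) (p x)"
    by metis
  define n where "n x = normalize_vec (p x)" for x
  have n: "n x = vec_scale (k x) (p x)" if "x \<in> frame" for x using k[OF that] by (simp add: n_def)
  have herm_n: "herm (n x) (n y) = f4_mult (k x) (f4_conj (k y))" if "x \<in> frame" "y \<in> frame" "x \<noteq> y" for x y
    using herm_p[OF that] by (simp add: n that herm_scale_left herm_scale_right f4_mult_commute)
  have n_surface: "n x \<in> set surface_points" if "x \<in> frame" for x
    using k[OF that] p0[OF that] iso[of x] unfolding set_surface_points n_def
    by (simp add: vec_scale_eq_0_iff herm_scale_left herm_scale_right normalize_vec_scale)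
  \<comment> \<open>Equal representatives would be isotropic with product 0, whereas distinct frame
    vectors have product 1 before scaling.\<close>
  have inj: "inj_on n frame"
  proof (rule inj_onI, rule ccontr)
    fix x y assume xy: "x \<in> frame" "y \<in> frame" "n x = n y" "x \<noteq> y"
    then have "herm (n x) (n y) = F0"
      using n_surface[OF xy(1)] by (simp add: set_surface_points)
    then have "f4_mult (k x) (f4_conj (k y)) = F0" using herm_n[OF xy(1,2,4)] by simp
    then show False using k[OF xy(1)] k[OF xy(2)] by (simp add: f4_mult_eq_0_iff)
  qed
  \<comment> \<open>Filtering puts the five points into the order of the enumeration.\<close>
  define l where "l = filter (\<lambda>q. q \<in> n ` frame) surface_points"
  have set_l: "set l = n ` frame" using n_surface by (auto simp: l_def)
  have dist: "distinct l" using distinct_surface_points by (simp add: l_def)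
  have "length l = card (n ` frame)" using distinct_card[OF dist] set_l by simp
  then have len: "length l = 5" using card_image[OF inj] card_frame by simp
  then obtain a ys where l: "l = a # ys" by (cases l) auto
  obtain x0 where x0: "x0 \<in> frame" "a = n x0" using set_l l by auto
  have ys: "\<exists>x. x \<in> frame \<and> x \<noteq> x0 \<and> y = n x" if "y \<in> set ys" for y
    using that dist set_l x0 unfolding l by (metis distinct.simps(2) imageE insertI2 list.simps(15))
  have "herm a y \<noteq> F0" if "y \<in> set ys" for y
    using ys[OF that] herm_n[OF x0(1)] k x0 by (auto simp: f4_mult_eq_0_iff)
  moreover have "sorted_wrt (unit_triple a) ys"
  proof (rule sorted_wrt_if_pairwise)
    show "distinct ys" using dist l by simp
    fix y z assume "y \<in> set ys" "z \<in> set ys" "y \<noteq> z"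
    then obtain x1 x2 where x: "x1 \<in> frame" "x2 \<in> frame" "x1 \<noteq> x0" "x2 \<noteq> x0" "y = n x1" "z = n x2" "x1 \<noteq> x2"
      using ys by metis
    then show "unit_triple a y z"
      using k[OF x0(1)] k[OF x(1)] k[OF x(2)] herm_n[OF x0(1) x(1)] herm_n[OF x(1,2)] herm_n[OF x(2) x0(1)]
      by (simp add: unit_triple_def x0(2) f4_norm_product)
  qed
  moreover have "subseq l surface_points" by (simp add: l_def subseq_filter_left)
  ultimately have "l \<in> set (ovoid_lists surface_points)"
    using len unfolding ovoid_lists_iff by (simp add: l)
  moreover have "frame_points M' = point_set M l"
    by (simp add: frame_points_def point_set_def set_l image_image p n_def pt_coord_normalize)
  ultimately show ?thesis by (rule that)
qed

end

section \<open>The ovoid graph\<close>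

lemma ovoid_lists_subset: "l \<in> set (ovoid_lists surface_points) \<Longrightarrow> set l \<subseteq> set surface_points"
  by (auto simp: ovoid_lists_iff dest: list_emb_set)

lemma ovoid_lists_inj:
  assumes "l \<in> set (ovoid_lists surface_points)" "l' \<in> set (ovoid_lists surface_points)" "set l = set l'"
  shows "l = l'"
  using assms subseq_eq_filter[OF _ distinct_surface_points] by (metis ovoid_lists_iff)

lemma card_ovoid_lists: "card (set (ovoid_lists surface_points)) = 216"
  using distinct_card[OF distinct_ovoid_lists[OF distinct_surface_points]] length_ovoid_lists by simp

lemma adj_code_iff:
  assumes "l \<in> set (ovoid_lists surface_points)" "set (quadrangle_list l) \<subseteq> set surface_points"
  shows "adj_code (ovoid_code l) (ovoid_code l') \<longleftrightarrow> card (set l \<inter> set l') = 1 \<and>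
    card (set (quadrangle_list l) \<inter> set (quadrangle_list l')) = 6"
proof -
  have "distinct l"
    using assms(1) subseq_eq_filter[OF _ distinct_surface_points] distinct_surface_points
    by (metis distinct_filter ovoid_lists_iff)
  moreover have "set (sift (\<lambda>x. elem x (quadrangle_list l)) surface_points) \<inter>
      set (sift (\<lambda>x. elem x (quadrangle_list l')) surface_points) =
      set (quadrangle_list l) \<inter> set (quadrangle_list l')"
    using assms(2) by (auto simp: sift_eq_filter elem_iff)
  moreover have "distinct (sift P surface_points)" for P
    by (simp add: sift_eq_filter distinct_surface_points)
  ultimately show ?thesis by (simp add: ovoid_code_in_def adj_test_iff count_common_eq)
qed

lemma length_filter_map_ovoid_code:
  "length (filter P (map ovoid_code (filter Q (ovoid_lists surface_points)))) =
     card {l \<in> set (ovoid_lists surface_points). Q l \<and> P (ovoid_code l)}"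
proof -
  have "filter P (map ovoid_code (filter Q (ovoid_lists surface_points))) =
      map ovoid_code (filter (\<lambda>l. Q l \<and> P (ovoid_code l)) (ovoid_lists surface_points))"
    by (simp add: filter_map o_def conj_commute)
  then show ?thesis
    using distinct_length_filter[OF distinct_ovoid_lists[OF distinct_surface_points]]
    by (simp add: Int_def conj_commute)
qed

lemma neighbours_ovoid0:
  "card {l \<in> set (ovoid_lists surface_points). adj_code (ovoid_code ovoid0) (ovoid_code l)} = 40"
proof -
  have "length (filter (adj_code (ovoid_code ovoid0)) (map ovoid_code (ovoid_lists surface_points))) = 40"
    using check_from_ovoid0 unfolding check_from_def check_common_def sift_eq_filter by blast
  then show ?thesis using length_filter_map_ovoid_code[of _ "\<lambda>_. True"] by simp
qed

lemma common_neighbours_ovoid0: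
  assumes "l \<in> set (ovoid_lists surface_points)" "l \<noteq> ovoid0"
  shows "card {z \<in> set (ovoid_lists surface_points). adj_code (ovoid_code ovoid0) (ovoid_code z) \<and>
      adj_code (ovoid_code l) (ovoid_code z)} =
    (if adj_code (ovoid_code ovoid0) (ovoid_code l) then 4 else 8)"
proof -
  have "fst (ovoid_code l) \<noteq> fst (ovoid_code ovoid0)"
    using assms(2) by (simp add: ovoid_code_in_def)
  moreover have "list_all (\<lambda>y. fst y = fst (ovoid_code ovoid0) \<or>
       length (filter (adj_code y) (filter (adj_code (ovoid_code ovoid0))
         (map ovoid_code (ovoid_lists surface_points)))) =
       (if adj_code (ovoid_code ovoid0) y then 4 else 8)) (map ovoid_code (ovoid_lists surface_points))"
    using check_from_ovoid0 unfolding check_from_def check_common_def sift_eq_filter by blast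
  ultimately have "length (filter (adj_code (ovoid_code l)) (filter (adj_code (ovoid_code ovoid0))
         (map ovoid_code (ovoid_lists surface_points)))) =
       (if adj_code (ovoid_code ovoid0) (ovoid_code l) then 4 else 8)"
    using assms(1) unfolding list_all_iff set_map ball_simps by meson
  then show ?thesis
    using length_filter_map_ovoid_code[of "adj_code (ovoid_code l)"
        "\<lambda>z. adj_code (ovoid_code ovoid0) (ovoid_code z)"]
    by (simp only: filter_map o_def)
qed

context hermitian_space
begin

lemma elliptic_ovoids_eq: "elliptic_ovoids (form_perp h) = frame_points ` {M. gram M}"
proof (intro equalityI subsetI)
  fix X assume "X \<in> elliptic_ovoids (form_perp h)"
  then obtain W where "symplectic_subquadrangle (form_perp h) W" "elliptic_ovoid W X"
    unfolding elliptic_ovoids_def by blast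
  then obtain M where "gram M" "X = frame_points M" by (rule symplectic_subquadrangle_frame)
  then show "X \<in> frame_points ` {M. gram M}" by blast
next
  fix X assume "X \<in> frame_points ` {M. gram M}"
  then obtain M where "gram M" "X = frame_points M" by blast
  then show "X \<in> elliptic_ovoids (form_perp h)"
    unfolding elliptic_ovoids_def using gram_subquadrangle by blast
qed

lemma subquadrangle_of_frame_points:
  assumes "gram M"
  shows "fst (subquadrangle_of (form_perp h) (frame_points M)) = baer_points M"
proof -
  define W where "W = (baer_points M, {l \<in> baer_lines M. card (l \<inter> frame_points M) = 1})"
  have "subquadrangle_of (form_perp h) (frame_points M) = W"
    unfolding subquadrangle_of_def
  proof (rule the_equality)
    show "symplectic_subquadrangle (form_perp h) W \<and> elliptic_ovoid W (frame_points M)"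
      using gram_subquadrangle[OF assms] by (simp add: W_def)
  next
    fix W' assume W': "symplectic_subquadrangle (form_perp h) W' \<and> elliptic_ovoid W' (frame_points M)"
    then obtain M' where M': "gram M'" "frame_points M = frame_points M'"
      "W' = (baer_points M', {l \<in> baer_lines M'. card (l \<inter> frame_points M) = 1})"
      by (elim conjE) (rule symplectic_subquadrangle_frame)
    then show "W' = W" using frame_points_determine[OF assms M'(1,2)] by (simp add: W_def)
  qed
  then show ?thesis by (simp add: W_def)
qed

text \<open>The Gram matrix is arbitrary, so each ovoid may choose the coordinates in which the
  enumeration is read.\<close>

lemma bij_betw_point_set:
  assumes M: "gram M"
  shows "bij_betw (point_set M) (set (ovoid_lists surface_points)) (elliptic_ovoids (form_perp h))"
  unfolding bij_betw_def
proof
  show "inj_on (point_set M) (set (ovoid_lists surface_points))"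
  proof (rule inj_onI)
    fix l l' assume l: "l \<in> set (ovoid_lists surface_points)" "l' \<in> set (ovoid_lists surface_points)"
      and "point_set M l = point_set M l'"
    then have "set l = set l'"
      using inj_on_image_eq_iff[OF inj_on_pt_coord[OF gram_invertible[OF M]]
        ovoid_lists_subset[OF l(1)] ovoid_lists_subset[OF l(2)]] by (simp add: point_set_def)
    then show "l = l'" by (rule ovoid_lists_inj[OF l])
  qed
  show "point_set M ` set (ovoid_lists surface_points) = elliptic_ovoids (form_perp h)"
  proof (intro equalityI subsetI)
    fix X assume "X \<in> point_set M ` set (ovoid_lists surface_points)"
    then obtain l where l: "X = point_set M l" "l \<in> set (ovoid_lists surface_points)" by (rule imageE)
    obtain M' where "gram M'" "frame_points M' = point_set M l"
      by (rule point_set_ovoid[OF M l(2)])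
    then show "X \<in> elliptic_ovoids (form_perp h)"
      unfolding elliptic_ovoids_eq using l(1) by blast
  next
    fix X assume "X \<in> elliptic_ovoids (form_perp h)"
    then obtain M' where M': "gram M'" "X = frame_points M'" unfolding elliptic_ovoids_eq by blast
    obtain l where "l \<in> set (ovoid_lists surface_points)" "frame_points M' = point_set M l"
      by (rule frame_points_in_point_sets[OF M M'(1)])
    then show "X \<in> point_set M ` set (ovoid_lists surface_points)" using M'(2) by blast
  qed
qed

text \<open>The substitute for transitivity of the unitary group: in the coordinates of its own
  matrix every ovoid is the base vertex of the computation.\<close>

lemma frame_points_ovoid0: "frame_points M = point_set M ovoid0"
proof -
  have "vec_emb (F1, F0, F0, F0) = axis 1 1" "vec_emb (F0, F1, F0, F0) = axis 2 1"
    "vec_emb (F0, F0, F1, F0) = axis 3 1" "vec_emb (F0, F0, F0, F1) = axis 4 1"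
    "vec_emb (F1, F1, F1, F1) = 1"
    by (simp_all add: vec_eq_iff forall_4 axis_def)
  moreover have "bit_vec (axis i 1) = axis i 1" for i by (simp add: bit_vec_def vec_eq_iff axis_def)
  moreover have "bit_vec 1 = 1" by (simp add: bit_vec_def vec_eq_iff)
  ultimately show ?thesis
    unfolding frame_points_def point_set_def frame_eq ovoid0_def baer_vec_eq coord_def list.set
      image_insert image_empty
    by (simp only:) blast
qed

lemma adjacent_point_sets:
  assumes M: "gram M" and l: "l \<in> set (ovoid_lists surface_points)" "l' \<in> set (ovoid_lists surface_points)"
  shows "(point_set M l, point_set M l') \<in> parcs (ovoid_graph (form_perp h)) \<longleftrightarrow>
    adj_code (ovoid_code l) (ovoid_code l')"
proof -
  note inv = gram_invertible[OF M]
  have el: "point_set M l \<in> elliptic_ovoids (form_perp h)" "point_set M l' \<in> elliptic_ovoids (form_perp h)"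
    using bij_betwE[OF bij_betw_point_set[OF M]] l by blast+
  have sub: "fst (subquadrangle_of (form_perp h) (point_set M x)) = point_set M (quadrangle_list x) \<and>
      set (quadrangle_list x) \<subseteq> set surface_points" if x: "x \<in> set (ovoid_lists surface_points)" for x
  proof -
    obtain M' where "gram M'" "frame_points M' = point_set M x"
        "baer_points M' = point_set M (quadrangle_list x)" "set (quadrangle_list x) \<subseteq> set surface_points"
      by (rule point_set_ovoid[OF M x])
    then show ?thesis using subquadrangle_of_frame_points by metis
  qed
  show ?thesis
    using el sub[OF l(1)] sub[OF l(2)] ovoid_lists_subset[OF l(1)] ovoid_lists_subset[OF l(2)]
    by (simp add: ovoid_graph_def adj_code_iff[OF l(1)] card_point_set_Int[OF inv])
qed

lemma card_elliptic_ovoids_Collect: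
  assumes "gram M"
  shows "card {Z \<in> elliptic_ovoids (form_perp h). P Z} =
    card {z \<in> set (ovoid_lists surface_points). P (point_set M z)}"
proof -
  note bij = bij_betw_point_set[OF assms]
  have "{Z \<in> elliptic_ovoids (form_perp h). P Z} =
      point_set M ` {z \<in> set (ovoid_lists surface_points). P (point_set M z)}"
    unfolding bij_betw_imp_surj_on[OF bij, symmetric] by blast
  moreover have "inj_on (point_set M) {z \<in> set (ovoid_lists surface_points). P (point_set M z)}"
    by (rule inj_on_subset[OF bij_betw_imp_inj_on[OF bij]]) blast
  ultimately show ?thesis by (simp add: card_image)
qed

lemma strongly_regular_ovoid_graph: "strongly_regular_graph (ovoid_graph (form_perp h)) 216 40 4 8"
proof -
  let ?O = "elliptic_ovoids (form_perp h)"
  define G where "G = ovoid_graph (form_perp h)"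
  have verts: "pverts G = ?O" by (simp add: G_def ovoid_graph_def)
  have arcs_verts: "X \<in> ?O \<and> Y \<in> ?O" if "(X, Y) \<in> parcs G" for X Y
    using that by (simp add: G_def ovoid_graph_def)
  have sym: "(Y, X) \<in> parcs G" if "(X, Y) \<in> parcs G" for X Y
    using that by (simp add: G_def ovoid_graph_def Int_commute)
  obtain M0 where M0: "gram M0" using ex_gram by blast
  have card: "card ?O = 216"
    using bij_betw_same_card[OF bij_betw_point_set[OF M0]] card_ovoid_lists by simp
  then have fin: "finite ?O" using card.infinite by fastforce
  have deg: "card {Z \<in> ?O. (X, Z) \<in> parcs G} = 40" if "X \<in> ?O" for X
  proof -
    obtain M where "gram M" "X = frame_points M" using \<open>X \<in> ?O\<close> unfolding elliptic_ovoids_eq by blast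
    then have M: "gram M" "X = point_set M ovoid0" by (simp_all only: frame_points_ovoid0)
    show ?thesis
      unfolding card_elliptic_ovoids_Collect[OF M(1)] G_def M(2) neighbours_ovoid0[symmetric]
      using adjacent_point_sets[OF M(1) ovoid0_in_ovoid_lists] by (intro arg_cong[where f = card]) blast
  qed
  have common: "card {Z \<in> ?O. (X, Z) \<in> parcs G \<and> (Y, Z) \<in> parcs G} = (if (X, Y) \<in> parcs G then 4 else 8)"
    if "X \<in> ?O" "Y \<in> ?O" "X \<noteq> Y" for X Y
  proof -
    obtain M where "gram M" "X = frame_points M" using \<open>X \<in> ?O\<close> unfolding elliptic_ovoids_eq by blast
    then have M: "gram M" "X = point_set M ovoid0" by (simp_all only: frame_points_ovoid0)
    have "Y \<in> point_set M ` set (ovoid_lists surface_points)"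
      using that(2) bij_betw_imp_surj_on[OF bij_betw_point_set[OF M(1)]] by simp
    then obtain l where l: "Y = point_set M l" "l \<in> set (ovoid_lists surface_points)" by (rule imageE)
    have "l \<noteq> ovoid0" using that(3) M(2) l(1) by blast
    note adj = adjacent_point_sets[OF M(1)]
    have "{z \<in> set (ovoid_lists surface_points). (X, point_set M z) \<in> parcs G \<and> (Y, point_set M z) \<in> parcs G} =
        {z \<in> set (ovoid_lists surface_points). adj_code (ovoid_code ovoid0) (ovoid_code z) \<and>
          adj_code (ovoid_code l) (ovoid_code z)}"
      unfolding G_def M(2) l(1) using adj[OF ovoid0_in_ovoid_lists] adj[OF l(2)] by blast
    then show ?thesis
      using common_neighbours_ovoid0[OF l(2) \<open>l \<noteq> ovoid0\<close>] adj[OF ovoid0_in_ovoid_lists l(2)]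
      unfolding card_elliptic_ovoids_Collect[OF M(1)] by (simp add: G_def M(2) l(1))
  qed
  have "pair_graph G"
  proof
    fix e assume e: "e \<in> parcs G"
    obtain X Y where "e = (X, Y)" by (cases e)
    then show "fst e \<in> pverts G" "snd e \<in> pverts G" using arcs_verts e verts by auto
    \<comment> \<open>An ovoid meets itself in five points, not in one.\<close>
    show "fst e \<noteq> snd e"
    proof
      assume eq: "fst e = snd e"
      then have "(X, X) \<in> parcs G" using e \<open>e = (X, Y)\<close> by simp
      then have "X \<in> ?O" "card (X \<inter> X) = 1" by (simp_all add: G_def ovoid_graph_def)
      moreover have "card X = 5" if "X \<in> ?O" for X
      proof -
        obtain M where M: "gram M" "X = frame_points M" using \<open>X \<in> ?O\<close> unfolding elliptic_ovoids_eq by blast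
        have "inj_on (\<lambda>x. pt (baer_vec M x)) frame"
          by (rule inj_onI) (use pt_baer_vec_eq_iff[OF gram_invertible[OF M(1)]] in \<open>auto simp: frame_def\<close>)
        then show ?thesis unfolding M(2) frame_points_def by (simp add: card_image card_frame)
      qed
      ultimately show False by fastforce
    qed
  next
    show "finite (pverts G)" by (simp add: verts fin)
    have "parcs G \<subseteq> ?O \<times> ?O" using arcs_verts by auto
    then show "finite (parcs G)" using fin finite_subset by blast
    show "symmetric G"
      unfolding symmetric_def by (auto intro!: symI sym)
  qed
  then interpret pair_graph G .
  have out: "out_degree (with_proj G) X = 40" if "X \<in> ?O" for X
  proof -
    have "out_arcs (with_proj G) X = Pair X ` {Z \<in> ?O. (X, Z) \<in> parcs G}"
      using arcs_verts by (auto simp: out_arcs_def)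
    then show ?thesis
      using deg[OF that] by (simp add: out_degree_def card_image inj_on_def)
  qed
  \<comment> \<open>Two distinct non-adjacent vertices have 8 common neighbours, so a path of length
    2 joins them.\<close>
  have reach: "X \<rightarrow>\<^sup>*\<^bsub>with_proj G\<^esub> Y" if "X \<in> ?O" "Y \<in> ?O" for X Y
  proof (cases "X = Y \<or> (X, Y) \<in> parcs G")
    case True
    then show ?thesis using that verts by auto
  next
    case False
    then have "card {Z \<in> ?O. (X, Z) \<in> parcs G \<and> (Y, Z) \<in> parcs G} = 8" using common that by simp
    then have "{Z \<in> ?O. (X, Z) \<in> parcs G \<and> (Y, Z) \<in> parcs G} \<noteq> {}" by (metis card.empty zero_neq_numeral)
    then obtain Z where Z: "(X, Z) \<in> parcs G" "(Z, Y) \<in> parcs G" using sym by blast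
    then have "X \<rightarrow>\<^sup>*\<^bsub>with_proj G\<^esub> Z" "Z \<rightarrow>\<^sup>*\<^bsub>with_proj G\<^esub> Y" by auto
    then show ?thesis by (rule reachable_trans)
  qed
  have conn: "Digraph_Component.connected (with_proj G)"
    unfolding Digraph_Component.connected_def strongly_connected_def
    using reachable_mk_symmetricI[OF reach] card verts by auto
  show ?thesis
    unfolding strongly_regular_graph_def G_def[symmetric] verts
  proof (intro conjI ballI impI)
    fix X Y assume XY: "X \<in> ?O" "Y \<in> ?O"
    show "card {Z \<in> ?O. (X, Z) \<in> parcs G \<and> (Y, Z) \<in> parcs G} = 4" if "(X, Y) \<in> parcs G"
      using common[OF XY] pair_no_loops[OF that] that by simp
    show "card {Z \<in> ?O. (X, Z) \<in> parcs G \<and> (Y, Z) \<in> parcs G} = 8" if "X \<noteq> Y \<and> (X, Y) \<notin> parcs G"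
      using common[OF XY] that by simp
  qed (use \<open>pair_graph G\<close> conn card out in simp_all)
qed

end

theorem theorem3p5:
  fixes perp :: "('a::{field,finite} ^ 4) set \<Rightarrow> ('a ^ 4) set"
  assumes "CARD('a) = 4"
    and "unitary_polarity perp"
  shows "strongly_regular_graph (ovoid_graph perp) 216 40 4 8"
proof -
  obtain h where h: "hermitian_form h" "nondegenerate h" "perp = form_perp h"
    using assms(2) by (auto simp: unitary_polarity_def)
  obtain w :: 'a where "(1::'a) + 1 = 0" "w \<noteq> 0" "w \<noteq> 1" "w * w = 1 + w" "UNIV = {0, 1, w, 1 + w}"
    by (rule card_four_field[OF assms(1)])
  then interpret hermitian_space w h using h(1,2) by unfold_locales auto
  show ?thesis unfolding h(3) by (rule strongly_regular_ovoid_graph)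
qed

end
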